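(* Let $S=\{s_1,\dots,s_k\}$ be a finite set, let $E\subseteq F_S$, and let $\Gamma=\langle S\mid E\rangle$. The following conditions are equivalent. (1) $E$ is BS-rigid. (2) For every sequence of functions $(f_\ell\colon\Gamma\to\mathrm{Sym}(n_\ell))_{\ell=1}^\infty$ with $n_\ell\to\infty$ such that $$d(f_\ell(\gamma_1\gamma_2),f_\ell(\gamma_1)f_\ell(\gamma_2))\to_{\ell\to\infty}0\qquad\forall\gamma_1,\gamma_2\in\Gamma,$$ if there is a sequence of homomorphisms $(g_\ell\colon\Gamma\to\mathrm{Sym}(n_\ell))_{\ell=1}^\infty$ such that $$d_{\mathrm{TV}}(N_{f_\ell,Q},N_{g_\ell,Q})\to_{\ell\to\infty}0\qquad\text{for every finite }Q\subset\Gamma,$$ then there is a sequence of homomorphisms $(h_\ell\colon\Gamma\to\mathrm{Sym}(n_\ell))_{\ell=1}^\infty$ such that $$d(f_\ell(\gamma),h_\ell(\gamma))\to_{\ell\to\infty}0\qquad\forall\gamma\in\Gamma.$$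
   Context: $F_S$ is the free group on $S$; $[n]=\{1,\dots,n\}$; $\mathrm{Sym}(n)$ is the symmetric group on $[n]$ with metric $d(\sigma,\tau)=\frac1n|\{x\in[n]\mid\sigma x\neq\tau x\}|$. For $\overline\sigma=(\sigma_1,\dots,\sigma_k)\in\mathrm{Sym}(n)^k$ and $w\in F_S$, $w(\overline\sigma)$ is the image of $w$ under the homomorphism $F_S\to\mathrm{Sym}(n)$ with $s_i\mapsto\sigma_i$. Put $\mathrm{Sol}_E(n)=\{\overline\sigma\in\mathrm{Sym}(n)^k\mid\forall w\in E,\ w(\overline\sigma)=\mathrm{id}\}$, and for $\varepsilon>0$ put $\mathrm{Sol}_E^{<\varepsilon}(n)=\{\overline\sigma\in\mathrm{Sym}(n)^k\mid\exists\overline\tau\in\mathrm{Sol}_E(n),\ \sum_{i=1}^kd(\sigma_i,\tau_i)<\varepsilon\}$ and $\mathrm{Sol}_E^{\ge\varepsilon}(n)=\mathrm{Sym}(n)^k\setminus\mathrm{Sol}_E^{<\varepsilon}(n)$. Total variation distance: $d_{\mathrm{TV}}(\theta_1,\theta_2)=\frac12\sum_{x\in\Omega}|\theta_1(x)-\theta_2(x)|$ for distributions on a finite set $\Omega$. For finite $P\subseteq F_S$ and $\overline\sigma\in\mathrm{Sym}(n)^k$, $N_{\overline\sigma,P}$ is the distribution on $2^P$ of $\{w\in P\mid w(\overline\sigma)x=x\}$ with $x$ uniform in $[n]$. For $f\colon\Gamma\to\mathrm{Sym}(n)$ and finite $Q\subset\Gamma$, $N_{f,Q}$ is the distribution on $2^Q$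 of $\{\gamma\in Q\mid f(\gamma)x=x\}$ with $x$ uniform in $[n]$. A subset $E\subseteq F_S$ is BS-rigid (Benjamini--Schramm-rigid) if for every $\varepsilon>0$ there exist a finite set $P\subseteq F_S$ and $\delta>0$ such that $d_{\mathrm{TV}}(N_{\overline\sigma,P},N_{\overline\tau,P})\ge\delta$ for every $n\in\mathbb{N}$, $\overline\sigma\in\mathrm{Sol}_E^{\ge\varepsilon}(n)$ and $\overline\tau\in\mathrm{Sol}_E(n)$. *)

theory Defs
  imports
    "HOL-Algebra.Coset"
    "HOL-Algebra.Sym_Groups"
    "HOL-Probability.Probability_Mass_Function"
begin

section \<open>Free groups and group presentations\<close>

text \<open>
  A letter \<open>(s, True)\<close> stands for the generator \<open>s\<close>, a letter \<open>(s, False)\<close> for its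
  formal inverse.  The free group on \<open>S\<close> consists of the reduced words in these letters.
\<close>

type_synonym 'a word = "('a \<times> bool) list"

definition inv_letter :: "'a \<times> bool \<Rightarrow> 'a \<times> bool" where
  "inv_letter x = (fst x, \<not> snd x)"

definition reduced_word :: "'a word \<Rightarrow> bool" where
  "reduced_word = successively (\<lambda>x y. y \<noteq> inv_letter x)"

fun cons_cancel :: "'a \<times> bool \<Rightarrow> 'a word \<Rightarrow> 'a word" where
  "cons_cancel x [] = [x]"
| "cons_cancel x (y # w) = (if y = inv_letter x then w else x # y # w)"

definition free_group :: "'a set \<Rightarrow> 'a word monoid" where
  "free_group S =
     \<lparr> carrier = {w. reduced_word w \<and> fst ` set w \<subseteq> S},
       mult = (\<lambda>u v. foldr cons_cancel u v),
       one = [] \<rparr>"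

text \<open>
  The image of \<open>w\<close> under the homomorphism to \<open>G\<close> that sends each generator \<open>s\<close> to \<open>\<sigma> s\<close>.
\<close>

fun word_eval :: "('g, 'm) monoid_scheme \<Rightarrow> ('a \<Rightarrow> 'g) \<Rightarrow> 'a word \<Rightarrow> 'g" where
  "word_eval G \<sigma> [] = \<one>\<^bsub>G\<^esub>"
| "word_eval G \<sigma> (x # w) =
     (if snd x then \<sigma> (fst x) else inv\<^bsub>G\<^esub> (\<sigma> (fst x))) \<otimes>\<^bsub>G\<^esub> word_eval G \<sigma> w"

definition normal_closure :: "('g, 'm) monoid_scheme \<Rightarrow> 'g set \<Rightarrow> 'g set" where
  "normal_closure G A = \<Inter> {N. N \<lhd> G \<and> A \<subseteq> N}"

definition presented_group :: "'a set \<Rightarrow> 'a word set \<Rightarrow> 'a word set monoid" where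
  "presented_group S E = free_group S Mod normal_closure (free_group S) E"


section \<open>Sanity checks for free groups and presentations\<close>

lemma inv_letter_simps [simp]:
  "inv_letter (inv_letter x) = x" "fst (inv_letter x) = fst x" "inv_letter x \<noteq> x"
  "snd (inv_letter x) = (\<not> snd x)"
  by (auto simp: inv_letter_def prod_eq_iff)

lemma reduced_word_Nil [simp]: "reduced_word []"
  by (simp add: reduced_word_def)

lemma reduced_word_Cons:
  "reduced_word (x # w) \<longleftrightarrow> reduced_word w \<and> (w = [] \<or> hd w \<noteq> inv_letter x)"
  by (cases w) (auto simp: reduced_word_def)

lemma reduced_cons_cancel: "reduced_word w \<Longrightarrow> reduced_word (cons_cancel x w)"
  by (cases w) (auto simp: reduced_word_Cons)

lemma reduced_foldr: "reduced_word v \<Longrightarrow> reduced_word (foldr cons_cancel u v)"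
  by (induction u) (auto simp: reduced_cons_cancel)

lemma set_cons_cancel: "set (cons_cancel x w) \<subseteq> insert x (set w)"
  by (cases w) auto

lemma set_foldr_cancel: "set (foldr cons_cancel u v) \<subseteq> set u \<union> set v"
proof (induction u)
  case (Cons x u)
  then show ?case using set_cons_cancel[of x "foldr cons_cancel u v"] by auto
qed auto

lemma cons_cancel_cancel:
  assumes "reduced_word w"
  shows "cons_cancel x (cons_cancel (inv_letter x) w) = w"
proof (cases w)
  case (Cons y v)
  then show ?thesis using assms by (cases v) (auto simp: reduced_word_Cons)
qed auto

lemma foldr_cons_cancel:
  assumes "reduced_word w"
  shows "foldr cons_cancel (cons_cancel x v) w = cons_cancel x (foldr cons_cancel v w)"
proof (cases v)
  case (Cons y v')
  then show ?thesis
    using cons_cancel_cancel[OF reduced_foldr[OF assms], of x v'] by auto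
qed auto

lemma foldr_cancel_assoc:
  assumes "reduced_word w"
  shows "foldr cons_cancel (foldr cons_cancel u v) w = foldr cons_cancel u (foldr cons_cancel v w)"
  by (induction u) (auto simp: foldr_cons_cancel[OF assms])

lemma foldr_cancel_Nil: "reduced_word u \<Longrightarrow> foldr cons_cancel u [] = u"
proof (induction u)
  case (Cons x u)
  then show ?case by (cases u) (auto simp: reduced_word_Cons)
qed auto

lemma foldr_cancel_inv:
  "reduced_word w \<Longrightarrow>
   foldr cons_cancel (rev (map inv_letter u)) (foldr cons_cancel u w) = w"
proof (induction u)
  case (Cons x u)
  have "cons_cancel (inv_letter x) (cons_cancel x (foldr cons_cancel u w)) = foldr cons_cancel u w"
    using cons_cancel_cancel[OF reduced_foldr[OF Cons.prems], of "inv_letter x" u] by simp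
  then show ?case using Cons by simp
qed auto

lemma group_free_group: "group (free_group S)"
proof (rule groupI)
  fix u assume u: "u \<in> carrier (free_group S)"
  define v where "v = foldr cons_cancel (rev (map inv_letter u)) []"
  have "set v \<subseteq> inv_letter ` set u"
    using set_foldr_cancel[of "rev (map inv_letter u)" "[]"] by (simp add: v_def)
  then have "v \<in> carrier (free_group S)"
    using u by (fastforce simp: free_group_def v_def reduced_foldr)
  moreover have "v \<otimes>\<^bsub>free_group S\<^esub> u = \<one>\<^bsub>free_group S\<^esub>"
    using u foldr_cancel_assoc[of u "rev (map inv_letter u)" "[]"] foldr_cancel_inv[of "[]" u]
    by (auto simp: free_group_def v_def foldr_cancel_Nil)
  ultimately show "\<exists>v\<in>carrier (free_group S). v \<otimes>\<^bsub>free_group S\<^esub> u = \<one>\<^bsub>free_group S\<^esub>"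
    by blast
next
  fix u v assume "u \<in> carrier (free_group S)" "v \<in> carrier (free_group S)"
  then show "u \<otimes>\<^bsub>free_group S\<^esub> v \<in> carrier (free_group S)"
    using set_foldr_cancel[of u v] by (fastforce simp: free_group_def reduced_foldr)
qed (auto simp: free_group_def foldr_cancel_assoc)

lemma generator_in_free_group: "s \<in> S \<Longrightarrow> [(s, True)] \<in> carrier (free_group S)"
  by (simp add: free_group_def reduced_word_def)

context group
begin

lemma word_eval_closed:
  assumes "\<And>s. s \<in> S \<Longrightarrow> \<sigma> s \<in> carrier G" "fst ` set w \<subseteq> S"
  shows "word_eval G \<sigma> w \<in> carrier G"
  using assms(2) by (induction w) (auto simp: assms(1))

lemma word_eval_cons_cancel:
  assumes \<sigma>: "\<And>s. s \<in> S \<Longrightarrow> \<sigma> s \<in> carrier G" and w: "fst ` set (x # w) \<subseteq> S"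
  shows "word_eval G \<sigma> (cons_cancel x w) = word_eval G \<sigma> (x # w)"
proof (cases w)
  case (Cons y v)
  have "word_eval G \<sigma> v \<in> carrier G"
    using w Cons by (intro word_eval_closed[OF \<sigma>]) auto
  then show ?thesis
    using w Cons \<sigma>[of "fst x"] by (auto simp: m_assoc[symmetric])
qed auto

lemma word_eval_foldr:
  assumes \<sigma>: "\<And>s. s \<in> S \<Longrightarrow> \<sigma> s \<in> carrier G"
    and u: "fst ` set u \<subseteq> S" and v: "fst ` set v \<subseteq> S"
  shows "word_eval G \<sigma> (foldr cons_cancel u v) = word_eval G \<sigma> u \<otimes> word_eval G \<sigma> v"
  using u
proof (induction u)
  case Nil
  then show ?case using word_eval_closed[OF \<sigma> v] by simp
next
  case (Cons x u)
  have "fst ` set (x # foldr cons_cancel u v) \<subseteq> S"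
    using Cons.prems v set_foldr_cancel[of u v] by fastforce
  from word_eval_cons_cancel[of S \<sigma>, OF \<sigma> this]
  have "word_eval G \<sigma> (foldr cons_cancel (x # u) v) =
      word_eval G \<sigma> (x # foldr cons_cancel u v)" by simp
  moreover have "word_eval G \<sigma> u \<in> carrier G" "word_eval G \<sigma> v \<in> carrier G"
    using Cons.prems v by (auto intro!: word_eval_closed[OF \<sigma>])
  ultimately show ?case
    using Cons \<sigma>[of "fst x"] by (auto simp: m_assoc)
qed

lemma word_eval_hom:
  assumes "\<And>s. s \<in> S \<Longrightarrow> \<sigma> s \<in> carrier G"
  shows "word_eval G \<sigma> \<in> hom (free_group S) G"
  using word_eval_closed[of S \<sigma>, OF assms] word_eval_foldr[of S \<sigma>, OF assms]
  by (auto simp: hom_def free_group_def)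

lemma word_eval_generator:
  assumes "\<sigma> s \<in> carrier G"
  shows "word_eval G \<sigma> [(s, True)] = \<sigma> s"
  using assms by simp

lemma word_eval_unique:
  assumes \<phi>: "\<phi> \<in> hom (free_group S) G" and \<sigma>: "\<And>s. s \<in> S \<Longrightarrow> \<phi> [(s, True)] = \<sigma> s"
    and w: "w \<in> carrier (free_group S)"
  shows "\<phi> w = word_eval G \<sigma> w"
proof -
  interpret F: group "free_group S" by (rule group_free_group)
  interpret \<phi>: group_hom "free_group S" G \<phi>
    using \<phi> by (simp add: group_hom_def group_hom_axioms_def F.group_axioms group_axioms)
  show ?thesis
    using w
  proof (induction w)
    case Nil
    show ?case using \<phi>.hom_one by (simp add: free_group_def)
  next
    case (Cons x w)
    have x: "fst x \<in> S" and w: "w \<in> carrier (free_group S)"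
      and xw: "[x] \<otimes>\<^bsub>free_group S\<^esub> w = x # w" "[x] \<in> carrier (free_group S)"
      using Cons.prems by (cases w; auto simp: free_group_def reduced_word_Cons)+
    have "[(fst x, False)] \<otimes>\<^bsub>free_group S\<^esub> [(fst x, True)] = \<one>\<^bsub>free_group S\<^esub>"
      by (simp add: free_group_def inv_letter_def)
    then have "inv\<^bsub>free_group S\<^esub> [(fst x, True)] = [(fst x, False)]"
      using x by (intro F.inv_equality) (auto simp: free_group_def reduced_word_def)
    then have "\<phi> [(fst x, False)] = inv (\<sigma> (fst x))"
      using \<phi>.hom_inv[OF generator_in_free_group[OF x]] \<sigma>[OF x] by simp
    then have "\<phi> [x] = (if snd x then \<sigma> (fst x) else inv (\<sigma> (fst x)))"
      using \<sigma>[OF x] by (cases x) auto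
    then show ?case
      using \<phi>.hom_mult[OF xw(2) w] xw(1) Cons.IH[OF w] by simp
  qed
qed

lemma normal_normal_closure:
  assumes "A \<subseteq> carrier G"
  shows "normal_closure G A \<lhd> G"
proof -
  have G: "carrier G \<lhd> G"
    by (auto simp: normal_inv_iff intro: subgroup_self)
  have sub: "subgroup (normal_closure G A) G"
    unfolding normal_closure_def using G assms
    by (intro subgroups_Inter) (auto dest: normal_imp_subgroup)
  show ?thesis
    using sub by (auto simp: normal_inv_iff normal_closure_def)
qed

end

lemma group_presented_group:
  assumes "E \<subseteq> carrier (free_group S)"
  shows "group (presented_group S E)"
  unfolding presented_group_def
  by (intro normal.factorgroup_is_group group.normal_normal_closure group_free_group assms)


section \<open>Permutations, solutions and Benjamini--Schramm rigidity\<close>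

definition perm_dist :: "nat \<Rightarrow> (nat \<Rightarrow> nat) \<Rightarrow> (nat \<Rightarrow> nat) \<Rightarrow> real" where
  "perm_dist n \<sigma> \<tau> = real (card {x \<in> {1..n}. \<sigma> x \<noteq> \<tau> x}) / real n"

text \<open>Tuples of permutations are indexed by the generating set \<open>S\<close> itself.\<close>

definition perm_tuples :: "'a set \<Rightarrow> nat \<Rightarrow> ('a \<Rightarrow> nat \<Rightarrow> nat) set" where
  "perm_tuples S n = (S \<rightarrow>\<^sub>E carrier (sym_group n))"

definition Sol :: "'a set \<Rightarrow> 'a word set \<Rightarrow> nat \<Rightarrow> ('a \<Rightarrow> nat \<Rightarrow> nat) set" where
  "Sol S E n = {\<sigma> \<in> perm_tuples S n. \<forall>w\<in>E. word_eval (sym_group n) \<sigma> w = id}"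

definition Sol_near :: "'a set \<Rightarrow> 'a word set \<Rightarrow> real \<Rightarrow> nat \<Rightarrow> ('a \<Rightarrow> nat \<Rightarrow> nat) set" where
  "Sol_near S E \<epsilon> n =
     {\<sigma> \<in> perm_tuples S n. \<exists>\<tau>\<in>Sol S E n. (\<Sum>s\<in>S. perm_dist n (\<sigma> s) (\<tau> s)) < \<epsilon>}"

definition Sol_far :: "'a set \<Rightarrow> 'a word set \<Rightarrow> real \<Rightarrow> nat \<Rightarrow> ('a \<Rightarrow> nat \<Rightarrow> nat) set" where
  "Sol_far S E \<epsilon> n = perm_tuples S n - Sol_near S E \<epsilon> n"

definition tv_dist :: "'b set \<Rightarrow> 'b pmf \<Rightarrow> 'b pmf \<Rightarrow> real" where
  "tv_dist \<Omega> \<theta>\<^sub>1 \<theta>\<^sub>2 = (1/2) * (\<Sum>x\<in>\<Omega>. \<bar>pmf \<theta>\<^sub>1 x - pmf \<theta>\<^sub>2 x\<bar>)"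

text \<open>
  Only meaningful for \<open>n \<ge> 1\<close>, since \<^const>\<open>pmf_of_set\<close> is unspecified on the empty set.
\<close>

definition fun_stab_pmf :: "nat \<Rightarrow> ('b \<Rightarrow> nat \<Rightarrow> nat) \<Rightarrow> 'b set \<Rightarrow> 'b set pmf" where
  "fun_stab_pmf n f Q = map_pmf (\<lambda>x. {q \<in> Q. f q x = x}) (pmf_of_set {1..n})"

definition tuple_stab_pmf ::
  "nat \<Rightarrow> ('a \<Rightarrow> nat \<Rightarrow> nat) \<Rightarrow> 'a word set \<Rightarrow> 'a word set pmf" where
  "tuple_stab_pmf n \<sigma> P =
     map_pmf (\<lambda>x. {w \<in> P. word_eval (sym_group n) \<sigma> w x = x}) (pmf_of_set {1..n})"

definition BS_rigid :: "'a set \<Rightarrow> 'a word set \<Rightarrow> bool" where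
  "BS_rigid S E \<longleftrightarrow>
     (\<forall>\<epsilon>>0. \<exists>P \<delta>. finite P \<and> P \<subseteq> carrier (free_group S) \<and> \<delta> > 0 \<and>
        (\<forall>n\<ge>1. \<forall>\<sigma>\<in>Sol_far S E \<epsilon> n. \<forall>\<tau>\<in>Sol S E n.
           tv_dist (Pow P) (tuple_stab_pmf n \<sigma> P) (tuple_stab_pmf n \<tau> P) \<ge> \<delta>))"

end

theory Submission
  imports Defs
begin

text \<open>
  An asymptotic homomorphism from \<open>\<Gamma>\<close> is determined, up to asymptotic equality, by its values on
  the generators: evaluating words in these values recovers it, because two words representing
  the same element of \<open>\<Gamma>\<close> differ by an element of the normal closure of \<open>E\<close>, and the words that
  asymptotically act trivially form a normal subgroup of the free group.  Convergence of stabilizer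
  statistics transfers along this correspondence, since total variation does not increase under
  reindexing and is bounded by the sum of the Hamming distances of the permutations involved.

  Given rigidity, the tuples \<open>f\<^sub>l s\<close> are thus eventually close to solutions, and the nearest
  solutions induce the homomorphisms sought.  Conversely, if rigidity fails for \<open>\<epsilon>\<close>, then testing
  against the finite sets of words of length at most \<open>l\<close> yields tuples far from every solution
  whose statistics approach those of solutions.  Each relator then fixes asymptotically all points.
  The sizes tend to infinity: a given tuple that is not a solution violates some relator at a
  fixed positive proportion of points, and there are only finitely many tuples of bounded size.
\<close>

section \<open>The normalized Hamming distance\<close>

lemma perm_dist_nonneg [simp]: "0 \<le> perm_dist n a b"
  by (simp add: perm_dist_def)

lemma perm_dist_refl [simp]: "perm_dist n a a = 0"
  by (simp add: perm_dist_def)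

lemma perm_dist_commute: "perm_dist n a b = perm_dist n b a"
proof -
  have "{x \<in> {1..n}. a x \<noteq> b x} = {x \<in> {1..n}. b x \<noteq> a x}"
    by auto
  then show ?thesis
    by (simp only: perm_dist_def)
qed

lemma perm_dist_triangle: "perm_dist n a c \<le> perm_dist n a b + perm_dist n b c"
proof -
  have "card {x \<in> {1..n}. a x \<noteq> c x} \<le> card ({x \<in> {1..n}. a x \<noteq> b x} \<union> {x \<in> {1..n}. b x \<noteq> c x})"
    by (intro card_mono) auto
  also have "\<dots> \<le> card {x \<in> {1..n}. a x \<noteq> b x} + card {x \<in> {1..n}. b x \<noteq> c x}"
    by (rule card_Un_le)
  finally show ?thesis
    unfolding perm_dist_def add_divide_distrib[symmetric]
    by (intro divide_right_mono) (simp_all flip: of_nat_add)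
qed

text \<open>If the composites differ at \<open>x\<close>, then either \<open>b\<close> and
  \<open>d\<close> differ at \<open>x\<close>, or \<open>a\<close> and \<open>c\<close> differ at
  \<open>b x\<close>. The inverse of \<open>b\<close> carries disagreements of the second kind back
  to \<open>x\<close> without increasing their number.\<close>

lemma perm_dist_comp_le:
  assumes "b permutes {1..n}"
  shows "perm_dist n (a \<circ> b) (c \<circ> d) \<le> perm_dist n a c + perm_dist n b d"
proof -
  let ?A = "{x \<in> {1..n}. a x \<noteq> c x}" and ?B = "{x \<in> {1..n}. b x \<noteq> d x}"
  have "{x \<in> {1..n}. (a \<circ> b) x \<noteq> (c \<circ> d) x} \<subseteq> (inv' b) ` ?A \<union> ?B"
  proof
    fix x assume x: "x \<in> {x \<in> {1..n}. (a \<circ> b) x \<noteq> (c \<circ> d) x}"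
    show "x \<in> (inv' b) ` ?A \<union> ?B"
    proof (cases "b x = d x")
      case True
      then have "b x \<in> ?A"
        using x permutes_in_image[OF assms, of x] by simp
      moreover have "x = inv' b (b x)"
        using permutes_inverses(2)[OF assms] by simp
      ultimately show ?thesis
        by (intro UnI1 image_eqI)
    qed (use x in auto)
  qed
  then have "card {x \<in> {1..n}. (a \<circ> b) x \<noteq> (c \<circ> d) x} \<le> card ((inv' b) ` ?A \<union> ?B)"
    by (intro card_mono) auto
  also have "\<dots> \<le> card ?A + card ?B"
    using card_Un_le[of "(inv' b) ` ?A" ?B] card_image_le[of ?A "inv' b"] by simp
  finally show ?thesis
    unfolding perm_dist_def add_divide_distrib[symmetric]
    by (intro divide_right_mono) (simp_all flip: of_nat_add)
qed

text \<open>With \<open>y = inv' a x\<close>, agreement of \<open>a\<close> and \<open>b\<close> at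
  \<open>y\<close> would force \<open>inv' b x = y\<close>. Hence the image under \<open>a\<close>
  of the disagreements of \<open>a\<close> and \<open>b\<close> contains those of the
  inverses.\<close>

lemma perm_dist_inv_le:
  assumes "a permutes {1..n}" "b permutes {1..n}"
  shows "perm_dist n (inv' a) (inv' b) \<le> perm_dist n a b"
proof -
  have "{x \<in> {1..n}. inv' a x \<noteq> inv' b x} \<subseteq> a ` {x \<in> {1..n}. a x \<noteq> b x}"
  proof
    fix x assume x: "x \<in> {x \<in> {1..n}. inv' a x \<noteq> inv' b x}"
    then have "inv' a x \<in> {x \<in> {1..n}. a x \<noteq> b x}"
      using assms permutes_in_image[OF permutes_inv[OF assms(1)], of x]
      using permutes_inverses(1)[OF assms(1), of x] permutes_inverses(2)[OF assms(2), of "inv' a x"]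
      by auto
    moreover have "x = a (inv' a x)"
      using permutes_inverses(1)[OF assms(1)] by simp
    ultimately show "x \<in> a ` {x \<in> {1..n}. a x \<noteq> b x}"
      by (intro image_eqI)
  qed
  then have "card {x \<in> {1..n}. inv' a x \<noteq> inv' b x} \<le> card {x \<in> {1..n}. a x \<noteq> b x}"
    by (intro surj_card_le) auto
  then show ?thesis
    by (simp add: perm_dist_def divide_right_mono)
qed

text \<open>A permutation of \<open>{1..n}\<close> that moves some point moves one of these
  \<open>n\<close> points. This gap is what later rules out bounded sizes.\<close>

lemma perm_dist_id_ge:
  assumes "a permutes {1..n}" "a \<noteq> id"
  shows "1 / real n \<le> perm_dist n a id"
proof -
  obtain x where x: "a x \<noteq> x"
    using assms(2) by (auto simp: fun_eq_iff)
  then have "x \<in> {x \<in> {1..n}. a x \<noteq> id x}"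
    using assms(1) by (auto simp: permutes_def)
  then have "1 \<le> card {x \<in> {1..n}. a x \<noteq> id x}"
    using card_gt_0_iff[of "{x \<in> {1..n}. a x \<noteq> id x}"] by fastforce
  then show ?thesis
    unfolding perm_dist_def by (intro divide_right_mono) auto
qed

text \<open>For sequences of permutations this is equality in the product of the groups
  Sym(\<open>n l\<close>) modulo the sequences converging to the identity. The rules below let
  composition and inversion descend to this quotient.\<close>

definition asymp_eq :: "(nat \<Rightarrow> nat) \<Rightarrow> (nat \<Rightarrow> nat \<Rightarrow> nat) \<Rightarrow> (nat \<Rightarrow> nat \<Rightarrow> nat) \<Rightarrow> bool" where
  "asymp_eq n a b \<longleftrightarrow> (\<lambda>l. perm_dist (n l) (a l) (b l)) \<longlonglongrightarrow> 0"

lemma asymp_eq_refl [simp]: "asymp_eq n a a"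
  by (simp add: asymp_eq_def)

lemma asymp_eq_sym: "asymp_eq n a b \<Longrightarrow> asymp_eq n b a"
  unfolding asymp_eq_def by (subst perm_dist_commute)

text \<open>One squeeze argument for transitivity, composition and inversion; a bound with a single
  term is covered by taking the same sequence twice in the second pair.\<close>

lemma asymp_eq_dominated:
  assumes "asymp_eq n a b" "asymp_eq n c d"
    and "\<And>l. perm_dist (n l) (p l) (q l) \<le> perm_dist (n l) (a l) (b l) + perm_dist (n l) (c l) (d l)"
  shows "asymp_eq n p q"
proof -
  have "(\<lambda>l. perm_dist (n l) (a l) (b l) + perm_dist (n l) (c l) (d l)) \<longlonglongrightarrow> 0"
    using tendsto_add[OF assms(1,2)[unfolded asymp_eq_def]] by simp
  then show ?thesis
    unfolding asymp_eq_def by (rule tendsto_0_le[where K = 1]) (simp add: assms(3))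
qed

lemma asymp_eq_trans [trans]: "asymp_eq n a b \<Longrightarrow> asymp_eq n b c \<Longrightarrow> asymp_eq n a c"
  by (rule asymp_eq_dominated) (assumption, assumption, rule perm_dist_triangle)

lemma asymp_eq_comp:
  assumes "asymp_eq n a c" "asymp_eq n b d" "\<And>l. b l permutes {1..n l}"
  shows "asymp_eq n (\<lambda>l. a l \<circ> b l) (\<lambda>l. c l \<circ> d l)"
  using assms(1,2) by (rule asymp_eq_dominated) (intro perm_dist_comp_le assms(3))

lemma asymp_eq_inv:
  assumes "asymp_eq n a b" "\<And>l. a l permutes {1..n l}" "\<And>l. b l permutes {1..n l}"
  shows "asymp_eq n (\<lambda>l. inv' (a l)) (\<lambda>l. inv' (b l))"
  using perm_dist_inv_le[OF assms(2,3)]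
  by (intro asymp_eq_dominated[OF assms(1) asymp_eq_refl[of n a]]) simp


section \<open>Total variation and stabilizer distributions\<close>

lemma tv_dist_nonneg [simp]: "0 \<le> tv_dist \<Omega> p q"
  by (simp add: tv_dist_def sum_nonneg)

lemma tv_dist_triangle: "tv_dist \<Omega> p r \<le> tv_dist \<Omega> p q + tv_dist \<Omega> q r"
proof -
  have "(\<Sum>x\<in>\<Omega>. \<bar>pmf p x - pmf r x\<bar>) \<le>
      (\<Sum>x\<in>\<Omega>. \<bar>pmf p x - pmf q x\<bar> + \<bar>pmf q x - pmf r x\<bar>)"
    by (intro sum_mono) simp
  then show ?thesis
    by (simp add: tv_dist_def sum.distrib)
qed

text \<open>The sum runs over all of \<Omega> with an indicator, and not over \<open>A\<close>, so
  that the sums for two distributions can be subtracted term by term.\<close>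

lemma measure_pmf_eq_sum:
  assumes "finite \<Omega>" "set_pmf p \<subseteq> \<Omega>"
  shows "measure_pmf.prob p A = (\<Sum>x\<in>\<Omega>. if x \<in> A then pmf p x else 0)"
proof -
  have "measure_pmf.prob p A = measure_pmf.prob p (\<Omega> \<inter> A)"
    using assms(2) by (intro measure_eq_AE) (auto simp: AE_measure_pmf_iff)
  also have "\<dots> = (\<Sum>x\<in>\<Omega> \<inter> A. pmf p x)"
    using assms(1) by (intro measure_measure_pmf_finite) auto
  finally show ?thesis
    using assms(1) by (simp add: sum.inter_restrict)
qed

text \<open>The right-hand side is the full l1 distance on \<Omega>. The factor 2 is not sharp, but
  only convergence to 0 matters.\<close>

lemma abs_prob_diff_le_tv_dist:
  assumes "finite \<Omega>" "set_pmf p \<subseteq> \<Omega>" "set_pmf q \<subseteq> \<Omega>"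
  shows "\<bar>measure_pmf.prob p A - measure_pmf.prob q A\<bar> \<le> 2 * tv_dist \<Omega> p q"
proof -
  have "\<bar>measure_pmf.prob p A - measure_pmf.prob q A\<bar> =
      \<bar>\<Sum>x\<in>\<Omega>. if x \<in> A then pmf p x - pmf q x else 0\<bar>"
    using assms by (subst (1 2) measure_pmf_eq_sum[of \<Omega>])
      (auto simp flip: sum_subtractf intro!: arg_cong[of _ _ abs] sum.cong)
  also have "\<dots> \<le> (\<Sum>x\<in>\<Omega>. \<bar>pmf p x - pmf q x\<bar>)"
    by (rule order_trans[OF sum_abs]) (intro sum_mono; simp)
  finally show ?thesis
    by (simp add: tv_dist_def)
qed

text \<open>The discrepancy at \<open>y\<close> is at most the sum of the discrepancies over its
  fibre, and each \<open>x\<close> lies in one fibre only, so exchanging the two sums gives the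
  bound.\<close>

lemma tv_dist_map_pmf_le:
  assumes "finite \<Omega>" "set_pmf p \<subseteq> \<Omega>" "set_pmf q \<subseteq> \<Omega>" "finite \<Omega>'"
  shows "tv_dist \<Omega>' (map_pmf \<phi> p) (map_pmf \<phi> q) \<le> tv_dist \<Omega> p q"
proof -
  have "\<bar>pmf (map_pmf \<phi> p) y - pmf (map_pmf \<phi> q) y\<bar> \<le>
      (\<Sum>x\<in>\<Omega>. if y = \<phi> x then \<bar>pmf p x - pmf q x\<bar> else 0)" for y
  proof -
    have "pmf (map_pmf \<phi> p) y - pmf (map_pmf \<phi> q) y =
        (\<Sum>x\<in>\<Omega>. if y = \<phi> x then pmf p x - pmf q x else 0)"
      using assms unfolding pmf_map
      by (subst (1 2) measure_pmf_eq_sum[of \<Omega>]) (auto simp flip: sum_subtractf intro!: sum.cong)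
    also have "\<bar>\<dots>\<bar> \<le> (\<Sum>x\<in>\<Omega>. if y = \<phi> x then \<bar>pmf p x - pmf q x\<bar> else 0)"
      by (rule order_trans[OF sum_abs]) (intro sum_mono; simp)
    finally show ?thesis .
  qed
  then have "(\<Sum>y\<in>\<Omega>'. \<bar>pmf (map_pmf \<phi> p) y - pmf (map_pmf \<phi> q) y\<bar>) \<le>
      (\<Sum>y\<in>\<Omega>'. \<Sum>x\<in>\<Omega>. if y = \<phi> x then \<bar>pmf p x - pmf q x\<bar> else 0)"
    by (intro sum_mono)
  also have "\<dots> = (\<Sum>x\<in>\<Omega>. \<Sum>y\<in>\<Omega>'. if y = \<phi> x then \<bar>pmf p x - pmf q x\<bar> else 0)"
    by (rule sum.swap)
  also have "\<dots> \<le> (\<Sum>x\<in>\<Omega>. \<bar>pmf p x - pmf q x\<bar>)"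
    using assms(4) by (intro sum_mono) simp
  finally show ?thesis
    by (simp add: tv_dist_def)
qed

text \<open>A coupling inequality: \<open>F\<close> and \<open>G\<close> distribute the mass outside
  \<open>?D\<close> identically, and each adds at most the mass of \<open>?D\<close>. The resulting
  factor 2 cancels against the one half in \<open>tv_dist\<close>.\<close>

lemma tv_dist_map_pmf_le_prob:
  assumes "finite \<Omega>"
  shows "tv_dist \<Omega> (map_pmf F p) (map_pmf G p) \<le> measure_pmf.prob p {y. F y \<noteq> G y}"
proof -
  let ?D = "{y. F y \<noteq> G y}"
  have split: "pmf (map_pmf H p) x =
      measure_pmf.prob p (H -` {x} - ?D) + measure_pmf.prob p (H -` {x} \<inter> ?D)" for H x
    unfolding pmf_map
    by (subst measure_pmf.finite_measure_Union[symmetric]) (auto intro!: arg_cong[where f = "measure_pmf.prob p"])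
  have sum: "(\<Sum>x\<in>\<Omega>. measure_pmf.prob p (H -` {x} \<inter> ?D)) \<le> measure_pmf.prob p ?D" for H
    using assms
    by (subst measure_pmf.finite_measure_finite_Union[symmetric])
       (auto simp: disjoint_family_on_def intro!: measure_pmf.finite_measure_mono)
  have "\<bar>pmf (map_pmf F p) x - pmf (map_pmf G p) x\<bar> \<le>
      measure_pmf.prob p (F -` {x} \<inter> ?D) + measure_pmf.prob p (G -` {x} \<inter> ?D)" for x
  proof -
    have "F -` {x} - ?D = G -` {x} - ?D"
      by auto
    then have "measure_pmf.prob p (F -` {x} - ?D) = measure_pmf.prob p (G -` {x} - ?D)"
      by simp
    then show ?thesis
      unfolding split[of F] split[of G]
      using measure_nonneg[of p "F -` {x} \<inter> ?D"] measure_nonneg[of p "G -` {x} \<inter> ?D"] by linarith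
  qed
  then have "(\<Sum>x\<in>\<Omega>. \<bar>pmf (map_pmf F p) x - pmf (map_pmf G p) x\<bar>) \<le>
      (\<Sum>x\<in>\<Omega>. measure_pmf.prob p (F -` {x} \<inter> ?D) + measure_pmf.prob p (G -` {x} \<inter> ?D))"
    by (intro sum_mono)
  also have "\<dots> \<le> 2 * measure_pmf.prob p ?D"
    using sum[of F] sum[of G] by (simp add: sum.distrib)
  finally show ?thesis
    by (simp add: tv_dist_def)
qed

section \<open>Stabilizer statistics of functions into symmetric groups\<close>

lemma prob_neq_eq_perm_dist:
  assumes "n \<ge> 1"
  shows "measure_pmf.prob (pmf_of_set {1..n}) {x. a x \<noteq> b x} = perm_dist n a b"
  using assms by (simp add: measure_pmf_of_set perm_dist_def Int_def)

lemma tuple_stab_pmf_eq: "tuple_stab_pmf n \<sigma> P = fun_stab_pmf n (word_eval (sym_group n) \<sigma>) P"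
  by (simp add: tuple_stab_pmf_def fun_stab_pmf_def)

lemma set_fun_stab_pmf: "set_pmf (fun_stab_pmf n f Q) \<subseteq> Pow Q"
  by (auto simp: fun_stab_pmf_def)

lemma fun_stab_pmf_cong:
  "(\<And>q. q \<in> Q \<Longrightarrow> f q = g q) \<Longrightarrow> fun_stab_pmf n f Q = fun_stab_pmf n g Q"
  unfolding fun_stab_pmf_def by (intro map_pmf_cong) auto

text \<open>Sample one point \<open>x\<close> for both distributions: the two subsets of
  \<open>Q\<close> differ only if \<open>f q x\<close> and \<open>g q x\<close> differ for some
  \<open>q\<close>, and a union bound applies.\<close>

lemma tv_dist_fun_stab_pmf_le_sum:
  assumes "n \<ge> 1" "finite Q"
  shows "tv_dist (Pow Q) (fun_stab_pmf n f Q) (fun_stab_pmf n g Q) \<le>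
    (\<Sum>q\<in>Q. perm_dist n (f q) (g q))"
proof -
  let ?p = "pmf_of_set {1..n}"
  have "tv_dist (Pow Q) (fun_stab_pmf n f Q) (fun_stab_pmf n g Q) \<le>
      measure_pmf.prob ?p {x. {q \<in> Q. f q x = x} \<noteq> {q \<in> Q. g q x = x}}"
    unfolding fun_stab_pmf_def using assms(2) by (intro tv_dist_map_pmf_le_prob) auto
  also have "\<dots> \<le> measure_pmf.prob ?p (\<Union>q\<in>Q. {x. f q x \<noteq> g q x})"
    by (intro measure_pmf.finite_measure_mono) auto
  also have "\<dots> \<le> (\<Sum>q\<in>Q. measure_pmf.prob ?p {x. f q x \<noteq> g q x})"
    using assms(2) by (intro measure_pmf.finite_measure_subadditive_finite) auto
  finally show ?thesis
    by (simp only: prob_neq_eq_perm_dist[OF assms(1)])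
qed

text \<open>The subset of \<open>Q\<close> seen at a point is the preimage under
  \<open>\<phi>\<close> of the subset of \<open>P\<close> seen there, so the statistics on
  \<open>Q\<close> are a push-forward of those on \<open>P\<close>. This serves for the quotient map
  onto \<Gamma>, for a section of it and for inclusions of test sets.\<close>

lemma tv_dist_fun_stab_pmf_reindex:
  assumes "finite P" "finite Q" "\<phi> ` Q \<subseteq> P"
  shows "tv_dist (Pow Q) (fun_stab_pmf n (\<lambda>q. f (\<phi> q)) Q) (fun_stab_pmf n (\<lambda>q. g (\<phi> q)) Q) \<le>
    tv_dist (Pow P) (fun_stab_pmf n f P) (fun_stab_pmf n g P)"
proof -
  have "fun_stab_pmf n (\<lambda>q. h (\<phi> q)) Q = map_pmf (\<lambda>A. {q \<in> Q. \<phi> q \<in> A}) (fun_stab_pmf n h P)"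
    for h
    unfolding fun_stab_pmf_def map_pmf_comp using assms(3) by (intro map_pmf_cong) auto
  from this[of f] this[of g] show ?thesis
    using assms(1,2) by (simp only:) (intro tv_dist_map_pmf_le set_fun_stab_pmf; simp)
qed

text \<open>The event that \<open>w\<close> is missing from the random subset has probability equal
  to the distance from the identity. Thus the statistics detect whether a relator acts almost
  trivially.\<close>

lemma perm_dist_id_diff_le_tv_dist:
  assumes "n \<ge> 1" "finite P" "w \<in> P"
  shows "\<bar>perm_dist n (f w) id - perm_dist n (g w) id\<bar> \<le>
    2 * tv_dist (Pow P) (fun_stab_pmf n f P) (fun_stab_pmf n g P)"
proof -
  have "measure_pmf.prob (fun_stab_pmf n h P) {A. w \<notin> A} = perm_dist n (h w) id" for h
    using assms(3) prob_neq_eq_perm_dist[OF assms(1), of "h w" id]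
    by (simp add: fun_stab_pmf_def vimage_def)
  from this[of f] this[of g] show ?thesis
    using abs_prob_diff_le_tv_dist[OF finite_Pow_iff[THEN iffD2, OF assms(2)]
        set_fun_stab_pmf[of n f P] set_fun_stab_pmf[of n g P], of "{A. w \<notin> A}"]
    by simp
qed


section \<open>Asymptotic homomorphisms\<close>

text \<open>This is the kernel of the homomorphism that the \<open>\<psi> l\<close> induce into the
  product of symmetric groups modulo null sequences.\<close>

lemma asymp_kernel_normal:
  assumes "group G" and \<psi>: "\<And>l. \<psi> l \<in> hom G (sym_group (n l))"
  shows "{x \<in> carrier G. asymp_eq n (\<lambda>l. \<psi> l x) (\<lambda>l. id)} \<lhd> G" (is "?K \<lhd> G")
proof -
  interpret group G by fact
  have hom: "group_hom G (sym_group (n l)) (\<psi> l)" for l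
    using \<psi> sym_group_is_group by (simp add: group_hom_def group_hom_axioms_def group_axioms)
  have perm: "\<psi> l x permutes {1..n l}" if "x \<in> carrier G" for l x
    using group_hom.hom_closed[OF hom that] by (simp add: sym_group_carrier)
  have mult: "\<psi> l (x \<otimes>\<^bsub>G\<^esub> y) = \<psi> l x \<circ> \<psi> l y" if "x \<in> carrier G" "y \<in> carrier G" for l x y
    using group_hom.hom_mult[OF hom that] by (simp add: sym_group_mult)
  have inv: "\<psi> l (inv\<^bsub>G\<^esub> x) = inv' (\<psi> l x)" if "x \<in> carrier G" for l x
    using group_hom.hom_inv[OF hom that] group_hom.hom_closed[OF hom that] by simp
  have mult_closed: "x \<otimes>\<^bsub>G\<^esub> y \<in> ?K" if "x \<in> ?K" "y \<in> ?K" for x y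
    using that asymp_eq_comp[of n "\<lambda>l. \<psi> l x" "\<lambda>l. id" "\<lambda>l. \<psi> l y" "\<lambda>l. id"] perm[of y]
    by (simp add: mult)
  have inv_closed: "inv\<^bsub>G\<^esub> x \<in> ?K" if "x \<in> ?K" for x
    using that asymp_eq_inv[of n "\<lambda>l. \<psi> l x" "\<lambda>l. id"] perm[of x]
    by (simp add: inv permutes_id inv_id)
  have "subgroup ?K G"
    using mult_closed inv_closed group_hom.hom_one[OF hom]
    by (intro subgroupI) (auto simp: sym_group_one)
  moreover have "g \<otimes>\<^bsub>G\<^esub> x \<otimes>\<^bsub>G\<^esub> inv\<^bsub>G\<^esub> g \<in> ?K" if g: "g \<in> carrier G" and x: "x \<in> ?K" for g x
  proof -
    have "asymp_eq n (\<lambda>l. \<psi> l g \<circ> \<psi> l x) (\<lambda>l. \<psi> l g \<circ> id)"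
      using x perm[of x] by (intro asymp_eq_comp) auto
    then have "asymp_eq n (\<lambda>l. (\<psi> l g \<circ> \<psi> l x) \<circ> inv' (\<psi> l g)) (\<lambda>l. (\<psi> l g \<circ> id) \<circ> inv' (\<psi> l g))"
      using permutes_inv[OF perm[OF g]] by (rule asymp_eq_comp[OF _ asymp_eq_refl])
    then show ?thesis
      using g x permutes_inv_o(1)[OF perm[OF g]] by (simp add: mult inv)
  qed
  ultimately show ?thesis
    by (simp add: normal_inv_iff)
qed

definition asymp_hom ::
  "(nat \<Rightarrow> nat) \<Rightarrow> ('g, 'm) monoid_scheme \<Rightarrow> (nat \<Rightarrow> 'g \<Rightarrow> nat \<Rightarrow> nat) \<Rightarrow> bool" where
  "asymp_hom n G f \<longleftrightarrow> (\<forall>l. f l \<in> carrier G \<rightarrow> carrier (sym_group (n l))) \<and>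
     (\<forall>x\<in>carrier G. \<forall>y\<in>carrier G. asymp_eq n (\<lambda>l. f l (x \<otimes>\<^bsub>G\<^esub> y)) (\<lambda>l. f l x \<circ> f l y))"

context group
begin

context
  fixes n f
  assumes f: "asymp_hom n G f"
begin

lemma asymp_hom_permutes: "x \<in> carrier G \<Longrightarrow> f l x permutes {1..n l}"
  using f by (auto simp: asymp_hom_def Pi_iff sym_group_carrier)

lemma asymp_hom_mult:
  "x \<in> carrier G \<Longrightarrow> y \<in> carrier G \<Longrightarrow> asymp_eq n (\<lambda>l. f l (x \<otimes> y)) (\<lambda>l. f l x \<circ> f l y)"
  using f by (simp add: asymp_hom_def)

text \<open>The value at the identity is asymptotically its own square, and one factor cancels
  exactly because it is a permutation.\<close>

lemma asymp_hom_one: "asymp_eq n (\<lambda>l. f l \<one>) (\<lambda>l. id)"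
proof -
  have perm: "f l \<one> permutes {1..n l}" for l
    by (rule asymp_hom_permutes) simp
  have "asymp_eq n (\<lambda>l. inv' (f l \<one>) \<circ> f l \<one>) (\<lambda>l. inv' (f l \<one>) \<circ> (f l \<one> \<circ> f l \<one>))"
    using asymp_hom_mult[of \<one> \<one>] perm by (intro asymp_eq_comp) auto
  then show ?thesis
    using permutes_inv_o(2)[OF perm] by (auto simp flip: comp_assoc intro: asymp_eq_sym)
qed

text \<open>The product \<open>f l (inv x) \<circ> f l x\<close> is asymptotically
  \<open>f l \<one>\<close>, hence \<open>id\<close>; composing with the exact inverse of
  \<open>f l x\<close> on the right isolates the first factor.\<close>

lemma asymp_hom_inv:
  assumes x: "x \<in> carrier G"
  shows "asymp_eq n (\<lambda>l. f l (inv x)) (\<lambda>l. inv' (f l x))"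
proof -
  have "asymp_eq n (\<lambda>l. f l (inv x) \<circ> f l x) (\<lambda>l. id)"
    using asymp_eq_sym[OF asymp_hom_mult[of "inv x" x]] asymp_hom_one x
    by (auto intro: asymp_eq_trans)
  then have "asymp_eq n (\<lambda>l. (f l (inv x) \<circ> f l x) \<circ> inv' (f l x)) (\<lambda>l. id \<circ> inv' (f l x))"
    using permutes_inv[OF asymp_hom_permutes[OF x]] by (intro asymp_eq_comp) auto
  then show ?thesis
    using permutes_inv_o(1)[OF asymp_hom_permutes[OF x]] by (simp add: comp_assoc)
qed

end

end


section \<open>Evaluating words in tuples of permutations\<close>

lemma perm_tuples_permutes: "\<sigma> \<in> perm_tuples S n \<Longrightarrow> s \<in> S \<Longrightarrow> \<sigma> s permutes {1..n}"
  unfolding sym_group_carrier[symmetric] by (auto simp: perm_tuples_def)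

lemma finite_perm_tuples: "finite S \<Longrightarrow> finite (perm_tuples S n)"
  by (auto simp: perm_tuples_def sym_group_def intro!: finite_PiE finite_permutations)

lemma Sol_subset_perm_tuples: "Sol S E n \<subseteq> perm_tuples S n"
  by (auto simp: Sol_def)

lemma Sol_subset_Sol_near: "\<epsilon> > 0 \<Longrightarrow> Sol S E n \<subseteq> Sol_near S E \<epsilon> n"
  by (force simp: Sol_near_def Sol_def)

lemma word_eval_hom_sym_group:
  "\<sigma> \<in> perm_tuples S n \<Longrightarrow> word_eval (sym_group n) \<sigma> \<in> hom (free_group S) (sym_group n)"
  by (intro group.word_eval_hom[OF sym_group_is_group]) (auto simp: perm_tuples_def)

lemma word_eval_permutes:
  "\<sigma> \<in> perm_tuples S n \<Longrightarrow> fst ` set w \<subseteq> S \<Longrightarrow> word_eval (sym_group n) \<sigma> w permutes {1..n}"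
  unfolding sym_group_carrier[symmetric]
  by (rule group.word_eval_closed[OF sym_group_is_group, of S]) (auto simp: perm_tuples_def)

lemma word_eval_sym_group_Cons:
  assumes "\<sigma> \<in> perm_tuples S n" "fst x \<in> S"
  shows "word_eval (sym_group n) \<sigma> (x # w) =
    (if snd x then \<sigma> (fst x) else inv' (\<sigma> (fst x))) \<circ> word_eval (sym_group n) \<sigma> w"
  using perm_tuples_permutes[OF assms] by (simp add: sym_group_mult sym_group_carrier)

lemma word_eval_sym_group_generator:
  assumes "\<sigma> \<in> perm_tuples S n" "s \<in> S"
  shows "word_eval (sym_group n) \<sigma> [(s, True)] = \<sigma> s"
  using assms by (intro group.word_eval_generator[OF sym_group_is_group]) (auto simp: perm_tuples_def)

text \<open>The number of letters of \<open>w\<close> does not depend on \<open>l\<close>, so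
  finitely many null errors add up, one for each letter.\<close>

lemma asymp_eq_word_eval:
  assumes \<sigma>: "\<And>l. \<sigma> l \<in> perm_tuples S (n l)" and \<tau>: "\<And>l. \<tau> l \<in> perm_tuples S (n l)"
    and eq: "\<And>s. s \<in> S \<Longrightarrow> asymp_eq n (\<lambda>l. \<sigma> l s) (\<lambda>l. \<tau> l s)"
    and w: "fst ` set w \<subseteq> S"
  shows "asymp_eq n (\<lambda>l. word_eval (sym_group (n l)) (\<sigma> l) w)
    (\<lambda>l. word_eval (sym_group (n l)) (\<tau> l) w)"
  using w
proof (induction w)
  case (Cons x w)
  then have x: "fst x \<in> S" and w: "fst ` set w \<subseteq> S"
    by auto
  have "asymp_eq n (\<lambda>l. if snd x then \<sigma> l (fst x) else inv' (\<sigma> l (fst x)))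
      (\<lambda>l. if snd x then \<tau> l (fst x) else inv' (\<tau> l (fst x)))"
    using eq[OF x] asymp_eq_inv[OF eq[OF x]] perm_tuples_permutes[OF \<sigma> x] perm_tuples_permutes[OF \<tau> x]
    by (cases "snd x") auto
  then show ?case
    unfolding word_eval_sym_group_Cons[OF \<sigma> x] word_eval_sym_group_Cons[OF \<tau> x]
    using Cons.IH[OF w] word_eval_permutes[OF \<sigma> w] by (rule asymp_eq_comp)
qed simp

text \<open>The first letter of a reduced word does not cancel against the rest, so induction on
  lists is also induction on products with single letters.\<close>

lemma free_group_Cons:
  assumes "x # w \<in> carrier (free_group S)"
  shows "fst x \<in> S" "[x] \<in> carrier (free_group S)" "w \<in> carrier (free_group S)"
    "[x] \<otimes>\<^bsub>free_group S\<^esub> w = x # w"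
  using assms by (cases w; auto simp: free_group_def reduced_word_Cons)+

lemma free_group_inv_generator:
  assumes "s \<in> S"
  shows "inv\<^bsub>free_group S\<^esub> [(s, True)] = [(s, False)]"
  using assms
  by (intro group.inv_equality[OF group_free_group])
     (auto simp: free_group_def reduced_word_def inv_letter_def)

text \<open>Each letter of \<open>w\<close> is split off at the price of a null error, by asymptotic
  multiplicativity, and an inverse letter is handled by \<open>asymp_hom_inv\<close>. Thus the
  values on the generators asymptotically determine \<open>f\<close> on the image of
  \<open>\<phi>\<close>.\<close>

lemma asymp_hom_word_eval:
  assumes G: "group G" and f: "asymp_hom n G f" and \<phi>: "\<phi> \<in> hom (free_group S) G"
    and \<sigma>: "\<And>l. \<sigma> l \<in> perm_tuples S (n l)" "\<And>l s. s \<in> S \<Longrightarrow> \<sigma> l s = f l (\<phi> [(s, True)])"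
    and w: "w \<in> carrier (free_group S)"
  shows "asymp_eq n (\<lambda>l. f l (\<phi> w)) (\<lambda>l. word_eval (sym_group (n l)) (\<sigma> l) w)"
proof -
  interpret group_hom "free_group S" G \<phi>
    using G \<phi> group_free_group by (simp add: group_hom_def group_hom_axioms_def)
  show ?thesis
    using w
  proof (induction w)
    case Nil
    then show ?case
      using H.asymp_hom_one[OF f] hom_one by (simp add: free_group_def sym_group_one id_def)
  next
    case (Cons x w)
    note x = free_group_Cons[OF Cons.prems]
    have \<phi>x: "\<phi> [(fst x, True)] \<in> carrier G"
      using x(1) by (intro hom_closed generator_in_free_group)
    have perm: "f l (\<phi> v) permutes {1..n l}" if "v \<in> carrier (free_group S)" for l v
      using that by (intro H.asymp_hom_permutes[OF f] hom_closed)
    have letter: "asymp_eq n (\<lambda>l. f l (\<phi> [x])) (\<lambda>l. if snd x then \<sigma> l (fst x) else inv' (\<sigma> l (fst x)))"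
    proof (cases "snd x")
      case True
      then show ?thesis
        using \<sigma>(2)[OF x(1)] by (cases x) simp
    next
      case False
      then have "\<phi> [x] = inv\<^bsub>G\<^esub> (\<phi> [(fst x, True)])"
        using hom_inv[OF generator_in_free_group[OF x(1)]] free_group_inv_generator[OF x(1)]
        by (cases x) simp
      then show ?thesis
        using H.asymp_hom_inv[OF f \<phi>x] False \<sigma>(2)[OF x(1)] by simp
    qed
    have "asymp_eq n (\<lambda>l. f l (\<phi> (x # w))) (\<lambda>l. f l (\<phi> [x]) \<circ> f l (\<phi> w))"
      using H.asymp_hom_mult[OF f hom_closed[OF x(2)] hom_closed[OF x(3)]] hom_mult[OF x(2,3)] x(4)
      by simp
    also have "asymp_eq n \<dots> (\<lambda>l. (if snd x then \<sigma> l (fst x) else inv' (\<sigma> l (fst x))) \<circ>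
        word_eval (sym_group (n l)) (\<sigma> l) w)"
      using letter Cons.IH[OF x(3)] perm[OF x(3)] by (rule asymp_eq_comp)
    finally show ?case
      unfolding word_eval_sym_group_Cons[OF \<sigma>(1) x(1)] .
  qed
qed


section \<open>Homomorphisms out of a presented group\<close>

locale presentation =
  fixes S :: "'a set" and E :: "'a word set"
  assumes relators: "E \<subseteq> carrier (free_group S)"
begin

abbreviation "\<Gamma> \<equiv> presented_group S E"

definition cls :: "'a word \<Rightarrow> 'a word set" where
  "cls w = normal_closure (free_group S) E #>\<^bsub>free_group S\<^esub> w"

sublocale F: group "free_group S"
  by (rule group_free_group)

sublocale \<Gamma>: group \<Gamma>
  using relators by (rule group_presented_group)

lemma normal_relators: "normal_closure (free_group S) E \<lhd> free_group S"
  using relators by (rule F.normal_normal_closure)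

lemma cls_hom: "cls \<in> hom (free_group S) \<Gamma>"
  using normal.r_coset_hom_Mod[OF normal_relators] by (simp add: cls_def[abs_def] presented_group_def)

sublocale cls: group_hom "free_group S" \<Gamma> cls
  by unfold_locales (rule cls_hom)

lemma cls_surj:
  assumes "\<gamma> \<in> carrier \<Gamma>"
  obtains w where "w \<in> carrier (free_group S)" "cls w = \<gamma>"
  using assms by (auto simp: presented_group_def carrier_FactGroup cls_def)

lemma cls_relator:
  assumes "w \<in> E"
  shows "cls w = \<one>\<^bsub>\<Gamma>\<^esub>"
proof -
  have "w \<in> normal_closure (free_group S) E"
    using assms by (auto simp: normal_closure_def)
  then show ?thesis
    using assms relators normal_imp_subgroup[OF normal_relators]
    by (auto simp: cls_def presented_group_def F.coset_join2)
qed

lemma cls_eqD: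
  assumes "u \<in> carrier (free_group S)" "v \<in> carrier (free_group S)" "cls u = cls v"
  shows "u \<otimes>\<^bsub>free_group S\<^esub> inv\<^bsub>free_group S\<^esub> v \<in> normal_closure (free_group S) E"
  using assms F.rcos_self[OF assms(1) normal_imp_subgroup[OF normal_relators]]
  by (intro subgroup.rcos_module_imp[OF normal_imp_subgroup[OF normal_relators] group_free_group])
     (simp_all add: cls_def)

lemma generator_closed: "s \<in> S \<Longrightarrow> cls [(s, True)] \<in> carrier \<Gamma>"
  by (intro cls.hom_closed generator_in_free_group)

text \<open>The kernel of word evaluation is normal and contains \<open>E\<close>, hence contains
  the normal closure, and evaluation factors through \<open>cls\<close>. Together with
  \<open>hom_imp_Sol\<close> this matches solutions with homomorphisms out of \<Gamma>.\<close>

lemma Sol_induced_hom: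
  assumes "\<sigma> \<in> Sol S E n"
  obtains h where "h \<in> hom \<Gamma> (sym_group n)"
    and "\<And>w. w \<in> carrier (free_group S) \<Longrightarrow> h (cls w) = word_eval (sym_group n) \<sigma> w"
proof -
  let ?e = "word_eval (sym_group n) \<sigma>"
  have \<sigma>: "\<sigma> \<in> perm_tuples S n" "\<And>w. w \<in> E \<Longrightarrow> ?e w = id"
    using assms by (auto simp: Sol_def)
  interpret e: group_hom "free_group S" "sym_group n" ?e
    using word_eval_hom_sym_group[OF \<sigma>(1)] sym_group_is_group
    by (simp add: group_hom_def group_hom_axioms_def F.group_axioms)
  have "E \<subseteq> kernel (free_group S) (sym_group n) ?e"
    using relators \<sigma>(2) by (auto simp: kernel_def sym_group_one)
  then have "normal_closure (free_group S) E \<subseteq> kernel (free_group S) (sym_group n) ?e"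
    unfolding normal_closure_def using e.normal_kernel by (intro Inter_lower) simp
  from e.FactGroup_universal_kernel[OF normal_relators this] show ?thesis
    using that unfolding presented_group_def cls_def by metis
qed

lemma hom_cls_eq_word_eval:
  assumes "h \<in> hom \<Gamma> (sym_group n)" "w \<in> carrier (free_group S)"
  shows "h (cls w) = word_eval (sym_group n) (\<lambda>s\<in>S. h (cls [(s, True)])) w"
  using group.word_eval_unique[OF sym_group_is_group hom_compose[OF cls_hom assms(1)] _ assms(2),
      of "\<lambda>s\<in>S. h (cls [(s, True)])"]
  by simp

lemma generators_in_perm_tuples:
  assumes "f \<in> carrier \<Gamma> \<rightarrow> carrier (sym_group n)"
  shows "(\<lambda>s\<in>S. f (cls [(s, True)])) \<in> perm_tuples S n"
  using assms generator_closed unfolding perm_tuples_def by auto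

lemma hom_imp_Sol:
  assumes "h \<in> hom \<Gamma> (sym_group n)"
  shows "(\<lambda>s\<in>S. h (cls [(s, True)])) \<in> Sol S E n"
proof -
  have "word_eval (sym_group n) (\<lambda>s\<in>S. h (cls [(s, True)])) w = id" if "w \<in> E" for w
    using hom_cls_eq_word_eval[OF assms, of w] cls_relator[OF that] that relators
      hom_one[OF assms \<Gamma>.group_axioms sym_group_is_group]
    by (auto simp: sym_group_one)
  moreover have "h \<in> carrier \<Gamma> \<rightarrow> carrier (sym_group n)"
    using assms by (auto simp: hom_def)
  ultimately show ?thesis
    by (auto simp: Sol_def intro: generators_in_perm_tuples)
qed

text \<open>The product of \<open>u\<close> with the inverse of \<open>v\<close> lies in the normal
  closure of \<open>E\<close>. The words acting asymptotically trivially form a normal subgroup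
  containing \<open>E\<close>, so this product is one of them, and \<open>v\<close> can be moved to
  the other side.\<close>

lemma asymp_eq_word_eval_cls:
  assumes \<sigma>: "\<And>l. \<sigma> l \<in> perm_tuples S (n l)"
    and E: "\<And>w. w \<in> E \<Longrightarrow> asymp_eq n (\<lambda>l. word_eval (sym_group (n l)) (\<sigma> l) w) (\<lambda>l. id)"
    and u: "u \<in> carrier (free_group S)" and v: "v \<in> carrier (free_group S)" and uv: "cls u = cls v"
  shows "asymp_eq n (\<lambda>l. word_eval (sym_group (n l)) (\<sigma> l) u) (\<lambda>l. word_eval (sym_group (n l)) (\<sigma> l) v)"
proof -
  let ?e = "\<lambda>l. word_eval (sym_group (n l)) (\<sigma> l)"
  let ?K = "{w \<in> carrier (free_group S). asymp_eq n (\<lambda>l. ?e l w) (\<lambda>l. id)}"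
  have hom: "group_hom (free_group S) (sym_group (n l)) (?e l)" for l
    using word_eval_hom_sym_group[OF \<sigma>] sym_group_is_group
    by (simp add: group_hom_def group_hom_axioms_def F.group_axioms)
  have perm: "?e l v permutes {1..n l}" for l
    using group_hom.hom_closed[OF hom v] by (simp add: sym_group_carrier)
  have "?K \<lhd> free_group S"
    using word_eval_hom_sym_group[OF \<sigma>] by (rule asymp_kernel_normal[OF group_free_group])
  moreover have "E \<subseteq> ?K"
    using relators E by auto
  ultimately have "normal_closure (free_group S) E \<subseteq> ?K"
    unfolding normal_closure_def by (intro Inter_lower) simp
  then have "asymp_eq n (\<lambda>l. ?e l (u \<otimes>\<^bsub>free_group S\<^esub> inv\<^bsub>free_group S\<^esub> v)) (\<lambda>l. id)"
    using cls_eqD[OF u v uv] by auto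
  moreover have "?e l (u \<otimes>\<^bsub>free_group S\<^esub> inv\<^bsub>free_group S\<^esub> v) = ?e l u \<circ> inv' (?e l v)" for l
    using group_hom.hom_mult[OF hom u F.inv_closed[OF v], of l] group_hom.hom_inv[OF hom v, of l]
      group_hom.hom_closed[OF hom v, of l]
    by (simp add: sym_group_mult)
  ultimately have "asymp_eq n (\<lambda>l. ?e l u \<circ> inv' (?e l v)) (\<lambda>l. id)"
    by simp
  then have "asymp_eq n (\<lambda>l. (?e l u \<circ> inv' (?e l v)) \<circ> ?e l v) (\<lambda>l. id \<circ> ?e l v)"
    using perm by (intro asymp_eq_comp) auto
  then show ?thesis
    using permutes_inv_o(2)[OF perm] by (simp add: comp_assoc)
qed

end


section \<open>Rigidity and stability\<close>

text \<open>A minimizer of the distance exists among the finitely many solutions. It serves every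
  \<epsilon> at once, which avoids a diagonal choice as \<epsilon> tends to 0.\<close>

lemma exists_nearest_Sol:
  assumes "finite S" "Sol S E n \<noteq> {}"
  obtains \<rho> where "\<rho> \<in> Sol S E n"
    and "\<And>\<epsilon>. \<sigma> \<in> Sol_near S E \<epsilon> n \<Longrightarrow> (\<Sum>s\<in>S. perm_dist n (\<sigma> s) (\<rho> s)) < \<epsilon>"
proof
  let ?d = "\<lambda>\<rho>. \<Sum>s\<in>S. perm_dist n (\<sigma> s) (\<rho> s)"
  have fin: "finite (Sol S E n)"
    using Sol_subset_perm_tuples finite_perm_tuples[OF assms(1)] by (rule finite_subset)
  show "arg_min_on ?d (Sol S E n) \<in> Sol S E n"
    using fin assms(2) by (rule arg_min_if_finite)
  show "?d (arg_min_on ?d (Sol S E n)) < \<epsilon>" if "\<sigma> \<in> Sol_near S E \<epsilon> n" for \<epsilon>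
    using that arg_min_least[OF fin assms(2), of _ ?d] by (force simp: Sol_near_def)
qed

context presentation
begin

section \<open>From rigidity to stability\<close>

lemma Sol_seq_induced_hom:
  assumes \<sigma>: "\<And>l. \<sigma> l \<in> Sol S E (n l)"
  obtains h where "\<And>l. h l \<in> hom \<Gamma> (sym_group (n l))"
    and "\<And>l w. w \<in> carrier (free_group S) \<Longrightarrow> h l (cls w) = word_eval (sym_group (n l)) (\<sigma> l) w"
proof -
  have "\<exists>h. h \<in> hom \<Gamma> (sym_group (n l)) \<and>
      (\<forall>w\<in>carrier (free_group S). h (cls w) = word_eval (sym_group (n l)) (\<sigma> l) w)" for l
    by (rule Sol_induced_hom[OF \<sigma>[of l]]) (intro exI conjI ballI)
  then have "\<exists>h. \<forall>l. h l \<in> hom \<Gamma> (sym_group (n l)) \<and>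
      (\<forall>w\<in>carrier (free_group S). h l (cls w) = word_eval (sym_group (n l)) (\<sigma> l) w)"
    by (intro choice allI)
  then obtain h where "\<forall>l. h l \<in> hom \<Gamma> (sym_group (n l)) \<and>
      (\<forall>w\<in>carrier (free_group S). h l (cls w) = word_eval (sym_group (n l)) (\<sigma> l) w)"
    by (rule exE)
  then show ?thesis
    by (intro that[of h]) simp_all
qed

text \<open>On the test set \<open>P\<close> given by rigidity, the statistics of the tuple from
  \<open>f l\<close> and of the solution from \<open>g l\<close> differ by a null sequence, so
  eventually by less than \<delta>, which a far tuple cannot do.\<close>

lemma BS_rigid_eventually_near:
  assumes S: "finite S" and rigid: "BS_rigid S E"
    and n: "\<And>l. n l \<ge> 1" and f: "asymp_hom n \<Gamma> f" and g: "\<And>l. g l \<in> hom \<Gamma> (sym_group (n l))"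
    and tv: "\<And>Q. finite Q \<Longrightarrow> Q \<subseteq> carrier \<Gamma> \<Longrightarrow>
      (\<lambda>l. tv_dist (Pow Q) (fun_stab_pmf (n l) (f l) Q) (fun_stab_pmf (n l) (g l) Q)) \<longlonglongrightarrow> 0"
    and \<epsilon>: "\<epsilon> > 0"
  shows "\<forall>\<^sub>F l in sequentially. (\<lambda>s\<in>S. f l (cls [(s, True)])) \<in> Sol_near S E \<epsilon> (n l)"
proof -
  define \<sigma> where "\<sigma> l = (\<lambda>s\<in>S. f l (cls [(s, True)]))" for l
  define \<tau> where "\<tau> l = (\<lambda>s\<in>S. g l (cls [(s, True)]))" for l
  have \<sigma>: "\<sigma> l \<in> perm_tuples S (n l)" for l
    using f unfolding \<sigma>_def by (intro generators_in_perm_tuples) (simp add: asymp_hom_def)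
  have \<tau>: "\<tau> l \<in> Sol S E (n l)" for l
    unfolding \<tau>_def by (intro hom_imp_Sol g)
  obtain P \<delta> where P: "finite P" "P \<subseteq> carrier (free_group S)" and \<delta>: "\<delta> > 0"
    and far: "\<And>n \<sigma> \<tau>. n \<ge> 1 \<Longrightarrow> \<sigma> \<in> Sol_far S E \<epsilon> n \<Longrightarrow> \<tau> \<in> Sol S E n \<Longrightarrow>
      tv_dist (Pow P) (tuple_stab_pmf n \<sigma> P) (tuple_stab_pmf n \<tau> P) \<ge> \<delta>"
    using rigid \<epsilon> unfolding BS_rigid_def by metis
  \<comment> \<open>\<open>A\<close> is the cost of replacing word evaluation by \<open>f\<close>,
    and \<open>B\<close> compares the statistics of \<open>f\<close> and \<open>g\<close> on the
    image of \<open>P\<close> in \<Gamma>, where \<open>tv\<close> applies.\<close>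
  define A where "A l = (\<Sum>w\<in>P. perm_dist (n l) (word_eval (sym_group (n l)) (\<sigma> l) w) (f l (cls w)))" for l
  define B where "B l = tv_dist (Pow (cls ` P)) (fun_stab_pmf (n l) (f l) (cls ` P))
    (fun_stab_pmf (n l) (g l) (cls ` P))" for l
  have le: "tv_dist (Pow P) (tuple_stab_pmf (n l) (\<sigma> l) P) (tuple_stab_pmf (n l) (\<tau> l) P) \<le> A l + B l" for l
  proof -
    have "tuple_stab_pmf (n l) (\<tau> l) P = fun_stab_pmf (n l) (\<lambda>w. g l (cls w)) P"
      unfolding tuple_stab_pmf_eq \<tau>_def
      by (intro fun_stab_pmf_cong hom_cls_eq_word_eval[symmetric] g) (use P(2) in auto)
    moreover have "tv_dist (Pow P) (tuple_stab_pmf (n l) (\<sigma> l) P) (fun_stab_pmf (n l) (\<lambda>w. f l (cls w)) P) \<le> A l"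
      unfolding tuple_stab_pmf_eq A_def by (intro tv_dist_fun_stab_pmf_le_sum n P(1))
    moreover have "tv_dist (Pow P) (fun_stab_pmf (n l) (\<lambda>w. f l (cls w)) P)
        (fun_stab_pmf (n l) (\<lambda>w. g l (cls w)) P) \<le> B l"
      unfolding B_def using P(1) by (intro tv_dist_fun_stab_pmf_reindex) auto
    ultimately show ?thesis
      using tv_dist_triangle[of "Pow P" "tuple_stab_pmf (n l) (\<sigma> l) P" "tuple_stab_pmf (n l) (\<tau> l) P"
          "fun_stab_pmf (n l) (\<lambda>w. f l (cls w)) P"] by simp
  qed
  have "asymp_eq n (\<lambda>l. word_eval (sym_group (n l)) (\<sigma> l) w) (\<lambda>l. f l (cls w))" if "w \<in> P" for w
    by (rule asymp_eq_sym, rule asymp_hom_word_eval[OF \<Gamma>.group_axioms f cls_hom \<sigma>])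
       (use that P(2) in \<open>auto simp: \<sigma>_def\<close>)
  then have "A \<longlonglongrightarrow> (\<Sum>w\<in>P. 0)"
    unfolding A_def asymp_eq_def by (intro tendsto_sum)
  moreover have "B \<longlonglongrightarrow> 0"
    unfolding B_def using P cls.hom_closed by (intro tv) auto
  ultimately have "(\<lambda>l. A l + B l) \<longlonglongrightarrow> 0"
    using tendsto_add[of A "\<Sum>w\<in>P. 0" sequentially B 0] by simp
  then have "\<forall>\<^sub>F l in sequentially. A l + B l < \<delta>"
    using \<delta> by (rule order_tendstoD)
  then show ?thesis
  proof eventually_elim
    case (elim l)
    then have "\<sigma> l \<notin> Sol_far S E \<epsilon> (n l)"
      using far[OF n _ \<tau>] le[of l] by fastforce
    then show ?case
      using \<sigma>[of l] by (simp add: Sol_far_def \<sigma>_def)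
  qed
qed

lemma BS_rigid_imp_stable:
  assumes S: "finite S" and rigid: "BS_rigid S E"
    and n: "\<And>l. n l \<ge> 1" and f: "asymp_hom n \<Gamma> f" and g: "\<And>l. g l \<in> hom \<Gamma> (sym_group (n l))"
    and tv: "\<And>Q. finite Q \<Longrightarrow> Q \<subseteq> carrier \<Gamma> \<Longrightarrow>
      (\<lambda>l. tv_dist (Pow Q) (fun_stab_pmf (n l) (f l) Q) (fun_stab_pmf (n l) (g l) Q)) \<longlonglongrightarrow> 0"
  obtains h where "\<And>l. h l \<in> hom \<Gamma> (sym_group (n l))"
    and "\<And>\<gamma>. \<gamma> \<in> carrier \<Gamma> \<Longrightarrow> asymp_eq n (\<lambda>l. f l \<gamma>) (\<lambda>l. h l \<gamma>)"
proof -
  define \<sigma> where "\<sigma> l = (\<lambda>s\<in>S. f l (cls [(s, True)]))" for l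
  have \<sigma>: "\<sigma> l \<in> perm_tuples S (n l)" for l
    using f unfolding \<sigma>_def by (intro generators_in_perm_tuples) (simp add: asymp_hom_def)
  have "\<exists>\<rho>. \<rho> \<in> Sol S E (n l) \<and>
      (\<forall>\<epsilon>. \<sigma> l \<in> Sol_near S E \<epsilon> (n l) \<longrightarrow> (\<Sum>s\<in>S. perm_dist (n l) (\<sigma> l s) (\<rho> s)) < \<epsilon>)" for l
  proof -
    \<comment> \<open>The values of \<open>g l\<close> on the generators form a solution, so there
      is one to be nearest to.\<close>
    have "Sol S E (n l) \<noteq> {}"
      using hom_imp_Sol[OF g[of l]] by auto
    then show ?thesis
      by (rule exists_nearest_Sol[OF S]) (intro exI conjI allI impI)
  qed
  then have "\<exists>\<rho>. \<forall>l. \<rho> l \<in> Sol S E (n l) \<and>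
      (\<forall>\<epsilon>. \<sigma> l \<in> Sol_near S E \<epsilon> (n l) \<longrightarrow> (\<Sum>s\<in>S. perm_dist (n l) (\<sigma> l s) (\<rho> l s)) < \<epsilon>)"
    by (intro choice allI)
  then obtain \<rho> where \<rho>: "\<And>l. \<rho> l \<in> Sol S E (n l)"
    and near: "\<And>l \<epsilon>. \<sigma> l \<in> Sol_near S E \<epsilon> (n l) \<Longrightarrow>
      (\<Sum>s\<in>S. perm_dist (n l) (\<sigma> l s) (\<rho> l s)) < \<epsilon>"
    by blast
  obtain h where h: "\<And>l. h l \<in> hom \<Gamma> (sym_group (n l))"
    and h_cls: "\<And>l w. w \<in> carrier (free_group S) \<Longrightarrow> h l (cls w) = word_eval (sym_group (n l)) (\<rho> l) w"
    by (rule Sol_seq_induced_hom[where \<sigma> = \<rho> and n = n, OF \<rho>]) (rule that)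
  have lim: "(\<lambda>l. \<Sum>s\<in>S. perm_dist (n l) (\<sigma> l s) (\<rho> l s)) \<longlonglongrightarrow> 0"
  proof (rule order_tendstoI)
    fix \<epsilon> :: real assume "\<epsilon> > 0"
    then have "\<forall>\<^sub>F l in sequentially. \<sigma> l \<in> Sol_near S E \<epsilon> (n l)"
      unfolding \<sigma>_def by (intro BS_rigid_eventually_near[OF S rigid n f g tv])
    then show "\<forall>\<^sub>F l in sequentially. (\<Sum>s\<in>S. perm_dist (n l) (\<sigma> l s) (\<rho> l s)) < \<epsilon>"
      by eventually_elim (rule near)
  next
    fix a :: real assume "a < 0"
    then show "\<forall>\<^sub>F l in sequentially. a < (\<Sum>s\<in>S. perm_dist (n l) (\<sigma> l s) (\<rho> l s))"
      by (intro always_eventually allI less_le_trans[OF _ sum_nonneg]) auto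
  qed
  have generators: "asymp_eq n (\<lambda>l. \<sigma> l s) (\<lambda>l. \<rho> l s)" if "s \<in> S" for s
    unfolding asymp_eq_def
  proof (rule tendsto_0_le[OF lim, where K = 1], rule always_eventually, rule allI)
    fix l
    show "norm (perm_dist (n l) (\<sigma> l s) (\<rho> l s)) \<le>
        norm (\<Sum>s\<in>S. perm_dist (n l) (\<sigma> l s) (\<rho> l s)) * 1"
      using member_le_sum[OF that, of "\<lambda>s. perm_dist (n l) (\<sigma> l s) (\<rho> l s)"] S
      by (simp add: sum_nonneg)
  qed
  show ?thesis
  proof (rule that[OF h])
    fix \<gamma> assume "\<gamma> \<in> carrier \<Gamma>"
    then obtain w where w: "w \<in> carrier (free_group S)" and \<gamma>: "cls w = \<gamma>"
      by (rule cls_surj)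
    \<comment> \<open>First pass from \<open>f\<close> to a word in its values on the generators,
      then replace these values by those of the nearest solution.\<close>
    have "asymp_eq n (\<lambda>l. f l (cls w)) (\<lambda>l. word_eval (sym_group (n l)) (\<sigma> l) w)"
      by (rule asymp_hom_word_eval[OF \<Gamma>.group_axioms f cls_hom \<sigma> _ w]) (simp add: \<sigma>_def)
    also have "asymp_eq n \<dots> (\<lambda>l. word_eval (sym_group (n l)) (\<rho> l) w)"
      using w \<rho> by (intro asymp_eq_word_eval[OF \<sigma> _ generators]) (auto simp: free_group_def Sol_def)
    finally show "asymp_eq n (\<lambda>l. f l \<gamma>) (\<lambda>l. h l \<gamma>)"
      by (simp add: h_cls[OF w] flip: \<gamma>)
  qed
qed

section \<open>From failing rigidity to failing stability\<close>

lemma filterlim_at_top_if_not_Sol: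
  assumes S: "finite S" and n: "\<And>l. n l \<ge> 1"
    and \<sigma>: "\<And>l. \<sigma> l \<in> perm_tuples S (n l)" "\<And>l. \<sigma> l \<notin> Sol S E (n l)"
    and E: "\<And>w. w \<in> E \<Longrightarrow> asymp_eq n (\<lambda>l. word_eval (sym_group (n l)) (\<sigma> l) w) (\<lambda>l. id)"
  shows "filterlim n at_top sequentially"
  unfolding filterlim_at_top
proof
  fix M
  \<comment> \<open>These are finitely many pairs of a positive size below \<open>M\<close> and a
    non-solution of that size; it suffices that the sequence eventually avoids each of them.\<close>
  define X where "X = Sigma {1..<M} (\<lambda>m. perm_tuples S m - Sol S E m)"
  have "\<forall>\<^sub>F l in sequentially. (n l, \<sigma> l) \<noteq> (m, \<rho>)" if "(m, \<rho>) \<in> X" for m \<rho>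
  proof -
    have m: "m \<ge> 1" and \<rho>: "\<rho> \<in> perm_tuples S m" "\<rho> \<notin> Sol S E m"
      using that by (auto simp: X_def)
    then obtain w where w: "w \<in> E" "word_eval (sym_group m) \<rho> w \<noteq> id"
      by (auto simp: Sol_def)
    have "fst ` set w \<subseteq> S"
      using w(1) relators by (auto simp: free_group_def)
    from perm_dist_id_ge[OF word_eval_permutes[OF \<rho>(1) this] w(2)]
    have ge: "1 / real m \<le> perm_dist m (word_eval (sym_group m) \<rho> w) id" .
    \<comment> \<open>Whenever the pair \<open>(m, \<rho>)\<close> occurs, the relator
      \<open>w\<close> chosen for it is at distance at least \<open>1 / m\<close> from the identity.
      One relator for each pair is enough, even if \<open>E\<close> is infinite.\<close>
    have "1 / real m > 0"
      using m by simp
    then have "\<forall>\<^sub>F l in sequentially. perm_dist (n l) (word_eval (sym_group (n l)) (\<sigma> l) w) id < 1 / real m"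
      using E[OF w(1)] unfolding asymp_eq_def by (intro order_tendstoD(2))
    then show ?thesis
      by eventually_elim (use ge in auto)
  qed
  moreover have "finite X"
    unfolding X_def using finite_perm_tuples[OF S] by auto
  ultimately have "\<forall>\<^sub>F l in sequentially. \<forall>x\<in>X. (n l, \<sigma> l) \<noteq> x"
    by (intro eventually_ball_finite) auto
  then show "\<forall>\<^sub>F l in sequentially. M \<le> n l"
  proof eventually_elim
    case (elim l)
    then have "(n l, \<sigma> l) \<notin> X"
      by blast
    then show ?case
      using n[of l] \<sigma>[of l] by (auto simp: X_def)
  qed
qed

text \<open>The negation of rigidity is applied to growing test sets and shrinking \<delta>, so that
  one sequence of pairs works for every fixed test set.\<close>

lemma not_BS_rigid_sequence:
  assumes S: "finite S" and "\<not> BS_rigid S E"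
  obtains \<epsilon> n \<sigma> \<tau> where "\<epsilon> > 0" "\<And>l. n l \<ge> 1" "filterlim n at_top sequentially"
    and "\<And>l. \<sigma> l \<in> Sol_far S E \<epsilon> (n l)" "\<And>l. \<tau> l \<in> Sol S E (n l)"
    and "\<And>w. w \<in> E \<Longrightarrow> asymp_eq n (\<lambda>l. word_eval (sym_group (n l)) (\<sigma> l) w) (\<lambda>l. id)"
    and "\<And>P. finite P \<Longrightarrow> P \<subseteq> carrier (free_group S) \<Longrightarrow>
      (\<lambda>l. tv_dist (Pow P) (tuple_stab_pmf (n l) (\<sigma> l) P) (tuple_stab_pmf (n l) (\<tau> l) P)) \<longlonglongrightarrow> 0"
proof -
  obtain \<epsilon> where \<epsilon>: "\<epsilon> > 0" and bad: "\<And>P \<delta>. finite P \<Longrightarrow> P \<subseteq> carrier (free_group S) \<Longrightarrow> \<delta> > 0 \<Longrightarrow>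
      \<exists>n\<ge>1. \<exists>\<sigma>\<in>Sol_far S E \<epsilon> n. \<exists>\<tau>\<in>Sol S E n.
        tv_dist (Pow P) (tuple_stab_pmf n \<sigma> P) (tuple_stab_pmf n \<tau> P) < \<delta>"
    using assms(2) unfolding BS_rigid_def by (auto simp: not_le)
  \<comment> \<open>Balls for the word length exhaust the free group by finite sets, because
    \<open>S\<close> is finite. The bound \<open>inverse (real (Suc l))\<close> used below is
    positive also at \<open>l = 0\<close>.\<close>
  define W where "W l = {w \<in> carrier (free_group S). length w \<le> l}" for l
  have W: "finite (W l)" "W l \<subseteq> carrier (free_group S)" for l
  proof -
    have "W l \<subseteq> {w. set w \<subseteq> S \<times> UNIV \<and> length w \<le> l}"
      by (auto simp: W_def free_group_def)
    then show "finite (W l)"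
      by (rule finite_subset) (intro finite_lists_length_le; simp add: S)
  qed (auto simp: W_def)
  have "\<exists>n \<sigma> \<tau>. n \<ge> 1 \<and> \<sigma> \<in> Sol_far S E \<epsilon> n \<and> \<tau> \<in> Sol S E n \<and>
      tv_dist (Pow (W l)) (tuple_stab_pmf n \<sigma> (W l)) (tuple_stab_pmf n \<tau> (W l)) < inverse (real (Suc l))" for l
    using bad[OF W, of "inverse (real (Suc l))" l] by auto
  then obtain n \<sigma> \<tau> where n: "\<And>l. n l \<ge> 1" and \<sigma>: "\<And>l. \<sigma> l \<in> Sol_far S E \<epsilon> (n l)"
    and \<tau>: "\<And>l. \<tau> l \<in> Sol S E (n l)"
    and tv: "\<And>l. tv_dist (Pow (W l)) (tuple_stab_pmf (n l) (\<sigma> l) (W l)) (tuple_stab_pmf (n l) (\<tau> l) (W l))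
      < inverse (real (Suc l))"
    by metis
  have lim: "(\<lambda>l. tv_dist (Pow P) (tuple_stab_pmf (n l) (\<sigma> l) P) (tuple_stab_pmf (n l) (\<tau> l) P)) \<longlonglongrightarrow> 0"
    if P: "finite P" "P \<subseteq> carrier (free_group S)" for P
  proof (rule tendsto_0_le[OF LIMSEQ_inverse_real_of_nat, where K = 1])
    have "\<forall>\<^sub>F l in sequentially. \<forall>w\<in>P. length w \<le> l"
      using P(1) by (intro eventually_ball_finite ballI eventually_ge_at_top)
    then show "\<forall>\<^sub>F l in sequentially.
        norm (tv_dist (Pow P) (tuple_stab_pmf (n l) (\<sigma> l) P) (tuple_stab_pmf (n l) (\<tau> l) P))
          \<le> norm (inverse (real (Suc l))) * 1"
    proof eventually_elim
      case (elim l)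
      then have "(\<lambda>w. w) ` P \<subseteq> W l"
        using P(2) by (auto simp: W_def)
      then have "tv_dist (Pow P) (tuple_stab_pmf (n l) (\<sigma> l) P) (tuple_stab_pmf (n l) (\<tau> l) P) \<le>
          tv_dist (Pow (W l)) (tuple_stab_pmf (n l) (\<sigma> l) (W l)) (tuple_stab_pmf (n l) (\<tau> l) (W l))"
        unfolding tuple_stab_pmf_eq by (rule tv_dist_fun_stab_pmf_reindex[OF W(1) P(1)])
      then show ?case
        using tv[of l] by simp
    qed
  qed
  have E: "asymp_eq n (\<lambda>l. word_eval (sym_group (n l)) (\<sigma> l) w) (\<lambda>l. id)" if "w \<in> E" for w
    unfolding asymp_eq_def
  proof (rule tendsto_0_le[OF lim[of "{w}"], where K = 2])
    show "{w} \<subseteq> carrier (free_group S)"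
      using that relators by auto
    show "\<forall>\<^sub>F l in sequentially.
        norm (perm_dist (n l) (word_eval (sym_group (n l)) (\<sigma> l) w) id) \<le>
        norm (tv_dist (Pow {w}) (tuple_stab_pmf (n l) (\<sigma> l) {w}) (tuple_stab_pmf (n l) (\<tau> l) {w})) * 2"
    proof (intro always_eventually allI)
      fix l
      \<comment> \<open>For the solution the distance to \<open>id\<close> vanishes, so the
        difference of distances reduces to the one for \<sigma>.\<close>
      have "word_eval (sym_group (n l)) (\<tau> l) w = id"
        using \<tau>[of l] that by (simp add: Sol_def)
      then show "norm (perm_dist (n l) (word_eval (sym_group (n l)) (\<sigma> l) w) id) \<le>
          norm (tv_dist (Pow {w}) (tuple_stab_pmf (n l) (\<sigma> l) {w}) (tuple_stab_pmf (n l) (\<tau> l) {w})) * 2"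
        using perm_dist_id_diff_le_tv_dist[of "n l" "{w}" w "word_eval (sym_group (n l)) (\<sigma> l)"
            "word_eval (sym_group (n l)) (\<tau> l)"] n[of l]
        unfolding tuple_stab_pmf_eq by simp
    qed
  qed simp
  \<comment> \<open>A solution is at distance 0 from itself, so a far tuple is not a solution, and
    the sizes must grow.\<close>
  have "\<sigma> l \<in> perm_tuples S (n l)" "\<sigma> l \<notin> Sol S E (n l)" for l
    using \<sigma>[of l] Sol_subset_Sol_near[OF \<epsilon>] by (auto simp: Sol_far_def)
  from filterlim_at_top_if_not_Sol[OF S n this E] have "filterlim n at_top sequentially" .
  from that[OF \<epsilon> n this \<sigma> \<tau> E lim] show ?thesis .
qed

text \<open>A tuple that is not a solution still defines a function on \<Gamma> through a choice of
  representing words. Since the relators act asymptotically trivially, the choice is harmless in the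
  limit.\<close>

lemma not_BS_rigid_imp_unstable:
  assumes S: "finite S" and "\<not> BS_rigid S E"
  obtains n f g where "\<And>l. n l \<ge> 1" "filterlim n at_top sequentially" "asymp_hom n \<Gamma> f"
    and "\<And>l. g l \<in> hom \<Gamma> (sym_group (n l))"
    and "\<And>Q. finite Q \<Longrightarrow> Q \<subseteq> carrier \<Gamma> \<Longrightarrow>
      (\<lambda>l. tv_dist (Pow Q) (fun_stab_pmf (n l) (f l) Q) (fun_stab_pmf (n l) (g l) Q)) \<longlonglongrightarrow> 0"
    and "\<nexists>h. (\<forall>l. h l \<in> hom \<Gamma> (sym_group (n l))) \<and>
      (\<forall>\<gamma>\<in>carrier \<Gamma>. asymp_eq n (\<lambda>l. f l \<gamma>) (\<lambda>l. h l \<gamma>))"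
proof -
  obtain \<epsilon> n \<sigma> \<tau>
    where \<epsilon>: "\<epsilon> > 0" and n: "\<And>l. n l \<ge> 1" "filterlim n at_top sequentially"
      and \<sigma>: "\<And>l. \<sigma> l \<in> Sol_far S E \<epsilon> (n l)" and \<tau>: "\<And>l. \<tau> l \<in> Sol S E (n l)"
      and E: "\<And>w. w \<in> E \<Longrightarrow> asymp_eq n (\<lambda>l. word_eval (sym_group (n l)) (\<sigma> l) w) (\<lambda>l. id)"
      and lim: "\<And>P. finite P \<Longrightarrow> P \<subseteq> carrier (free_group S) \<Longrightarrow>
        (\<lambda>l. tv_dist (Pow P) (tuple_stab_pmf (n l) (\<sigma> l) P) (tuple_stab_pmf (n l) (\<tau> l) P)) \<longlonglongrightarrow> 0"
    by (rule not_BS_rigid_sequence[OF assms]) (rule that)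
  have \<sigma>': "\<sigma> l \<in> perm_tuples S (n l)" for l
    using \<sigma>[of l] by (simp add: Sol_far_def)
  obtain g where g: "\<And>l. g l \<in> hom \<Gamma> (sym_group (n l))"
    and g_cls: "\<And>l w. w \<in> carrier (free_group S) \<Longrightarrow> g l (cls w) = word_eval (sym_group (n l)) (\<tau> l) w"
    by (rule Sol_seq_induced_hom[where \<sigma> = \<tau> and n = n, OF \<tau>]) (rule that)
  have "\<forall>\<gamma>\<in>carrier \<Gamma>. \<exists>w\<in>carrier (free_group S). cls w = \<gamma>"
    using cls_surj by blast
  then obtain rep where rep: "\<And>\<gamma>. \<gamma> \<in> carrier \<Gamma> \<Longrightarrow> rep \<gamma> \<in> carrier (free_group S)"
    and cls_rep: "\<And>\<gamma>. \<gamma> \<in> carrier \<Gamma> \<Longrightarrow> cls (rep \<gamma>) = \<gamma>"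
    by metis
  define f where "f l \<gamma> = word_eval (sym_group (n l)) (\<sigma> l) (rep \<gamma>)" for l \<gamma>
  \<comment> \<open>Another representative changes the value by a null error. For products of
    representatives this gives asymptotic multiplicativity, and for generators it recovers
    \<sigma>.\<close>
  have f_cls: "asymp_eq n (\<lambda>l. f l (cls w)) (\<lambda>l. word_eval (sym_group (n l)) (\<sigma> l) w)"
    if "w \<in> carrier (free_group S)" for w
    unfolding f_def using that
    by (intro asymp_eq_word_eval_cls \<sigma>' E) (auto simp: rep cls_rep)
  have hom: "word_eval (sym_group (n l)) (\<sigma> l) \<in> hom (free_group S) (sym_group (n l))" for l
    by (intro word_eval_hom_sym_group \<sigma>')
  show ?thesis
  proof (rule that[OF n _ g])
    show "asymp_hom n \<Gamma> f"
      unfolding asymp_hom_def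
    proof (intro conjI allI ballI)
      show "f l \<in> carrier \<Gamma> \<rightarrow> carrier (sym_group (n l))" for l
        using hom[of l] rep by (auto simp: f_def hom_def)
      fix \<gamma> \<delta> assume \<gamma>\<delta>: "\<gamma> \<in> carrier \<Gamma>" "\<delta> \<in> carrier \<Gamma>"
      then have "cls (rep \<gamma> \<otimes>\<^bsub>free_group S\<^esub> rep \<delta>) = \<gamma> \<otimes>\<^bsub>\<Gamma>\<^esub> \<delta>"
        by (simp add: rep cls_rep)
      moreover have "word_eval (sym_group (n l)) (\<sigma> l) (rep \<gamma> \<otimes>\<^bsub>free_group S\<^esub> rep \<delta>) = f l \<gamma> \<circ> f l \<delta>" for l
        using hom_mult[OF hom rep[OF \<gamma>\<delta>(1)] rep[OF \<gamma>\<delta>(2)], of l] by (simp add: f_def sym_group_mult)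
      ultimately show "asymp_eq n (\<lambda>l. f l (\<gamma> \<otimes>\<^bsub>\<Gamma>\<^esub> \<delta>)) (\<lambda>l. f l \<gamma> \<circ> f l \<delta>)"
        using f_cls[of "rep \<gamma> \<otimes>\<^bsub>free_group S\<^esub> rep \<delta>"] \<gamma>\<delta> by (simp add: rep)
    qed
  next
    fix Q assume Q: "finite Q" "Q \<subseteq> carrier \<Gamma>"
    have le: "tv_dist (Pow Q) (fun_stab_pmf (n l) (f l) Q) (fun_stab_pmf (n l) (g l) Q) \<le>
        tv_dist (Pow (rep ` Q)) (tuple_stab_pmf (n l) (\<sigma> l) (rep ` Q)) (tuple_stab_pmf (n l) (\<tau> l) (rep ` Q))" for l
    proof -
      \<comment> \<open>For the homomorphism \<open>g l\<close> the representative gives the exact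
        value, so both statistics on \<open>Q\<close> are reindexed along
        \<open>rep\<close>.\<close>
      have "fun_stab_pmf (n l) (g l) Q = fun_stab_pmf (n l) (\<lambda>\<gamma>. word_eval (sym_group (n l)) (\<tau> l) (rep \<gamma>)) Q"
        using Q(2) by (intro fun_stab_pmf_cong) (auto simp: cls_rep rep subset_iff simp flip: g_cls)
      then show ?thesis
        using tv_dist_fun_stab_pmf_reindex[of "rep ` Q" Q rep] Q(1)
        by (simp add: f_def[abs_def] tuple_stab_pmf_eq)
    qed
    have "(\<lambda>l. tv_dist (Pow (rep ` Q)) (tuple_stab_pmf (n l) (\<sigma> l) (rep ` Q))
        (tuple_stab_pmf (n l) (\<tau> l) (rep ` Q))) \<longlonglongrightarrow> 0"
      using Q rep by (intro lim) auto
    then show "(\<lambda>l. tv_dist (Pow Q) (fun_stab_pmf (n l) (f l) Q) (fun_stab_pmf (n l) (g l) Q)) \<longlonglongrightarrow> 0"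
      by (rule tendsto_0_le[where K = 1]) (simp add: le)
  next
    show "\<nexists>h. (\<forall>l. h l \<in> hom \<Gamma> (sym_group (n l))) \<and>
      (\<forall>\<gamma>\<in>carrier \<Gamma>. asymp_eq n (\<lambda>l. f l \<gamma>) (\<lambda>l. h l \<gamma>))"
    proof (intro notI, elim exE conjE)
      fix h assume h: "\<forall>l. h l \<in> hom \<Gamma> (sym_group (n l))"
        and fh: "\<forall>\<gamma>\<in>carrier \<Gamma>. asymp_eq n (\<lambda>l. f l \<gamma>) (\<lambda>l. h l \<gamma>)"
      \<comment> \<open>The homomorphisms \<open>h l\<close> would give solutions whose total
        distance to \<sigma> over the finitely many generators drops below \<epsilon>, although
        every \<open>\<sigma> l\<close> is far.\<close>
      define \<rho> where "\<rho> l = (\<lambda>s\<in>S. h l (cls [(s, True)]))" for l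
      have "(\<lambda>l. perm_dist (n l) (\<sigma> l s) (\<rho> l s)) \<longlonglongrightarrow> 0" if s: "s \<in> S" for s
      proof -
        have "asymp_eq n (\<lambda>l. \<sigma> l s) (\<lambda>l. f l (cls [(s, True)]))"
          using asymp_eq_sym[OF f_cls[OF generator_in_free_group[OF s]]]
          unfolding word_eval_sym_group_generator[OF \<sigma>' s] .
        also have "asymp_eq n \<dots> (\<lambda>l. h l (cls [(s, True)]))"
          by (intro fh[rule_format] generator_closed s)
        finally show ?thesis
          using s by (simp add: asymp_eq_def \<rho>_def)
      qed
      then have "(\<lambda>l. \<Sum>s\<in>S. perm_dist (n l) (\<sigma> l s) (\<rho> l s)) \<longlonglongrightarrow> (\<Sum>s\<in>S. 0)"
        by (intro tendsto_sum)
      then have "\<forall>\<^sub>F l in sequentially. (\<Sum>s\<in>S. perm_dist (n l) (\<sigma> l s) (\<rho> l s)) < \<epsilon>"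
        using \<epsilon> by (intro order_tendstoD(2)) auto
      then obtain l where "(\<Sum>s\<in>S. perm_dist (n l) (\<sigma> l s) (\<rho> l s)) < \<epsilon>"
        by (auto simp: eventually_sequentially)
      moreover have "\<rho> l \<in> Sol S E (n l)"
        unfolding \<rho>_def by (intro hom_imp_Sol h[rule_format])
      ultimately show False
        using \<sigma>[of l] by (auto simp: Sol_far_def Sol_near_def)
    qed
  qed
qed

end

text \<open>Sizes are kept positive so that the uniform distribution on \<open>{1..n l}\<close> is
  meaningful.\<close>

theorem proposition1p9:
  fixes S :: "'a set" and E :: "'a word set" and \<Gamma> :: "'a word set monoid"
  assumes "finite S"
    and "E \<subseteq> carrier (free_group S)"
    and "\<Gamma> = presented_group S E"
  shows "BS_rigid S E \<longleftrightarrow>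
    (\<forall>(n :: nat \<Rightarrow> nat) (f :: nat \<Rightarrow> 'a word set \<Rightarrow> nat \<Rightarrow> nat).
       (\<forall>l. n l \<ge> 1) \<and> filterlim n at_top sequentially \<and>
       (\<forall>l. f l \<in> carrier \<Gamma> \<rightarrow> carrier (sym_group (n l))) \<and>
       (\<forall>\<gamma>\<^sub>1\<in>carrier \<Gamma>. \<forall>\<gamma>\<^sub>2\<in>carrier \<Gamma>.
          (\<lambda>l. perm_dist (n l) (f l (\<gamma>\<^sub>1 \<otimes>\<^bsub>\<Gamma>\<^esub> \<gamma>\<^sub>2)) (f l \<gamma>\<^sub>1 \<otimes>\<^bsub>sym_group (n l)\<^esub> f l \<gamma>\<^sub>2))
            \<longlonglongrightarrow> 0) \<longrightarrow>
       (\<exists>g. (\<forall>l. g l \<in> hom \<Gamma> (sym_group (n l))) \<and>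
          (\<forall>Q. finite Q \<and> Q \<subseteq> carrier \<Gamma> \<longrightarrow>
             (\<lambda>l. tv_dist (Pow Q) (fun_stab_pmf (n l) (f l) Q) (fun_stab_pmf (n l) (g l) Q))
               \<longlonglongrightarrow> 0)) \<longrightarrow>
       (\<exists>h. (\<forall>l. h l \<in> hom \<Gamma> (sym_group (n l))) \<and>
          (\<forall>\<gamma>\<in>carrier \<Gamma>. (\<lambda>l. perm_dist (n l) (f l \<gamma>) (h l \<gamma>)) \<longlonglongrightarrow> 0)))"
    (is "_ \<longleftrightarrow> (\<forall>n f. ?A n f \<longrightarrow> ?G n f \<longrightarrow> ?H n f)")
proof -
  interpret presentation S E
    by unfold_locales (rule assms(2))
  \<comment> \<open>Multiplication in \<open>sym_group\<close> is composition, which turns the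
    hypothesis on \<open>f\<close> into \<open>asymp_hom\<close>.\<close>
  have A: "?A n f \<longleftrightarrow> (\<forall>l. n l \<ge> 1) \<and> filterlim n at_top sequentially \<and> asymp_hom n \<Gamma> f" for n f
    by (simp add: asymp_hom_def asymp_eq_def sym_group_mult)
  show ?thesis
  proof
    assume rigid: "BS_rigid S E"
    show "\<forall>n f. ?A n f \<longrightarrow> ?G n f \<longrightarrow> ?H n f"
    proof (intro allI impI)
      fix n f assume "?A n f" "?G n f"
      then have n: "\<And>l. n l \<ge> 1" and f: "asymp_hom n (presented_group S E) f"
        unfolding A unfolding assms(3) by blast+
      from \<open>?G n f\<close> obtain g where g: "\<And>l. g l \<in> hom (presented_group S E) (sym_group (n l))"
        and tv: "\<And>Q. finite Q \<Longrightarrow> Q \<subseteq> carrier (presented_group S E) \<Longrightarrow>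
          (\<lambda>l. tv_dist (Pow Q) (fun_stab_pmf (n l) (f l) Q) (fun_stab_pmf (n l) (g l) Q)) \<longlonglongrightarrow> 0"
        unfolding assms(3) by blast
      obtain h where "\<And>l. h l \<in> hom \<Gamma> (sym_group (n l))"
        and "\<And>\<gamma>. \<gamma> \<in> carrier \<Gamma> \<Longrightarrow> asymp_eq n (\<lambda>l. f l \<gamma>) (\<lambda>l. h l \<gamma>)"
        by (rule BS_rigid_imp_stable[OF assms(1) rigid n f g tv, folded assms(3)];
            (assumption | rule that; assumption))
      then show "?H n f"
        unfolding asymp_eq_def by (intro exI[of _ h]) simp
    qed
  next
    assume stable: "\<forall>n f. ?A n f \<longrightarrow> ?G n f \<longrightarrow> ?H n f"
    show "BS_rigid S E"
    proof (rule ccontr)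
      assume "\<not> BS_rigid S E"
      then obtain n f g where "\<And>l. n l \<ge> 1" "filterlim n at_top sequentially" "asymp_hom n \<Gamma> f"
        and "\<And>l. g l \<in> hom \<Gamma> (sym_group (n l))"
        and "\<And>Q. finite Q \<Longrightarrow> Q \<subseteq> carrier \<Gamma> \<Longrightarrow>
          (\<lambda>l. tv_dist (Pow Q) (fun_stab_pmf (n l) (f l) Q) (fun_stab_pmf (n l) (g l) Q)) \<longlonglongrightarrow> 0"
        and no_h: "\<nexists>h. (\<forall>l. h l \<in> hom \<Gamma> (sym_group (n l))) \<and>
          (\<forall>\<gamma>\<in>carrier \<Gamma>. asymp_eq n (\<lambda>l. f l \<gamma>) (\<lambda>l. h l \<gamma>))"
        by (rule not_BS_rigid_imp_unstable[OF assms(1), folded assms(3)]) (rule that)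
      then have A': "?A n f" and G': "?G n f"
        unfolding A by (simp_all, intro exI[of _ g], simp)
      have "?H n f"
        by (rule stable[THEN spec, THEN spec, THEN mp, THEN mp, OF A' G'])
      then show False
        using no_h unfolding asymp_eq_def by (rule notE[rotated])
    qed
  qed
qed

end
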